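(* Let $G$ be a transposable finite group and $G^{T}$ one of its transpose groups. Then to every normal subgroup $N\lhd G$ there can be assigned a normal subgroup $N^{T}\lhd G^{T}$ such that $|G/N|=|N^{T}|$ (equivalently $|N|=|G^{T}/N^{T}|$), and such that $(N_{1}N_{2})^{T}=N_{1}^{T}\cap N_{2}^{T}$ for all $N_1,N_2\lhd G$, so that the lattice of normal subgroups of $G$ is the dual of the lattice of normal subgroups of $G^{T}$, including orders of subgroups (i.e. $N\mapsto N^{T}$ is an anti-isomorphism between these lattices with $|N^T|=|G/N|$).
   Context: All groups are finite. A group $G$ with complex character table $X$ (rows indexed by irreducible characters, columns by conjugacy classes) is called transposable if there exist non-negative integer diagonal matrices $D$ and $N_0$ such that $\tilde X=(D^{-1}XN_0)^{T}$ is the character table (in a suitable ordering of rows and columns) of some finite group $G^{T}$, called a transpose group of $G$. Here $D$ is the diagonal matrix of the character degrees of $G$, and $N_0$ is the diagonal matrix of the character degrees of $G^T$. *)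

theory Defs
  imports "HOL-Algebra.Group_Action" "Jordan_Normal_Form.VS_Connect"
begin

definition GL :: "nat \<Rightarrow> complex mat monoid" where
  "GL n = units_of (ring_mat TYPE(complex) n ())"

text \<open>A representation of degree \<open>n\<close> is a homomorphism into \<open>GL n\<close>; it is irreducible if \<open>n > 0\<close>
  and the only invariant subspaces of \<open>\<complex>\<^sup>n\<close> are the trivial ones.\<close>

definition irreducible_rep ::
  "('a, 'm) monoid_scheme \<Rightarrow> nat \<Rightarrow> ('a \<Rightarrow> complex mat) \<Rightarrow> bool" where
  "irreducible_rep G n \<rho> \<longleftrightarrow>
     \<rho> \<in> hom G (GL n) \<and> n > 0 \<and>
     (\<forall>W. subspace class_ring W (module_vec TYPE(complex) n) \<and>
          (\<forall>g\<in>carrier G. \<forall>w\<in>W. \<rho> g *\<^sub>v w \<in> W) \<longrightarrow>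
          W = {0\<^sub>v n} \<or> W = carrier_vec n)"

text \<open>The character is \<open>undefined\<close> outside the carrier, so that distinct elements of \<open>irr_chars G\<close>
  really are distinct as functions on the group.\<close>

definition rep_character ::
  "('a, 'm) monoid_scheme \<Rightarrow> nat \<Rightarrow> ('a \<Rightarrow> complex mat) \<Rightarrow> 'a \<Rightarrow> complex" where
  "rep_character G n \<rho> = (\<lambda>g\<in>carrier G. \<Sum>i<n. \<rho> g $$ (i, i))"

definition irr_chars :: "('a, 'm) monoid_scheme \<Rightarrow> ('a \<Rightarrow> complex) set" where
  "irr_chars G = {rep_character G n \<rho> | n \<rho>. irreducible_rep G n \<rho>}"

definition conj_classes :: "('a, 'm) monoid_scheme \<Rightarrow> 'a set set" where
  "conj_classes G =
     orbits G (carrier G) (\<lambda>g. \<lambda>h\<in>carrier G. g \<otimes>\<^bsub>G\<^esub> h \<otimes>\<^bsub>G\<^esub> inv\<^bsub>G\<^esub> g)"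

text \<open>\<open>X\<close> is the character table of \<open>G\<close> for the ordering \<open>\<chi>s\<close> of the irreducible characters (rows)
  and the ordering \<open>Cs\<close> of the conjugacy classes (columns).\<close>

definition character_table ::
  "('a, 'm) monoid_scheme \<Rightarrow> ('a \<Rightarrow> complex) list \<Rightarrow> 'a set list \<Rightarrow> complex mat \<Rightarrow> bool" where
  "character_table G \<chi>s Cs X \<longleftrightarrow>
     distinct \<chi>s \<and> set \<chi>s = irr_chars G \<and>
     distinct Cs \<and> set Cs = conj_classes G \<and>
     X \<in> carrier_mat (length \<chi>s) (length Cs) \<and>
     (\<forall>i<length \<chi>s. \<forall>j<length Cs. \<forall>g\<in>Cs ! j. X $$ (i, j) = (\<chi>s ! i) g)"

definition degree_matrix ::
  "('a, 'm) monoid_scheme \<Rightarrow> ('a \<Rightarrow> complex) list \<Rightarrow> complex mat" where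
  "degree_matrix G \<chi>s = mat_diag (length \<chi>s) (\<lambda>i. (\<chi>s ! i) \<one>\<^bsub>G\<^esub>)"

text \<open>\<open>transpose_group G H\<close>: the finite group \<open>H\<close> is a transpose group of \<open>G\<close>. A finite group is
  transposable if it has a transpose group. The columns of \<open>X\<close>, hence the diagonal entries of \<open>N\<^sub>0\<close>,
  are matched with the irreducible characters \<open>\<psi>s\<close> of \<open>H\<close>, and the rows of \<open>X\<close> with the conjugacy
  classes \<open>Ks\<close> of \<open>H\<close>.\<close>

definition transpose_group ::
  "('a, 'm) monoid_scheme \<Rightarrow> ('b, 'n) monoid_scheme \<Rightarrow> bool" where
  "transpose_group G H \<longleftrightarrow>
     group H \<and> finite (carrier H) \<and>
     (\<exists>\<chi>s Cs X \<psi>s Ks D D' N\<^sub>0 (d :: nat \<Rightarrow> nat) (n :: nat \<Rightarrow> nat).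
        character_table G \<chi>s Cs X \<and>
        D = mat_diag (length \<chi>s) (\<lambda>i. of_nat (d i)) \<and> D = degree_matrix G \<chi>s \<and>
        N\<^sub>0 = mat_diag (length Cs) (\<lambda>j. of_nat (n j)) \<and> N\<^sub>0 = degree_matrix H \<psi>s \<and>
        D' \<in> carrier_mat (length \<chi>s) (length \<chi>s) \<and> inverts_mat D D' \<and> inverts_mat D' D \<and>
        character_table H \<psi>s Ks (transpose_mat (D' * X * N\<^sub>0)))"

end

theory Submission
  imports Defs "Jordan_Normal_Form.Schur_Decomposition" "HOL-Algebra.Multiplicative_Group"
    "HOL-Algebra.Zassenhaus"
begin

text \<open>Entry by entry, the relation between the two tables reads
\<open>\<chi>\<^sub>i(g\<^sub>j) / \<chi>\<^sub>i(1) = \<psi>\<^sub>j(h\<^sub>i) / \<psi>\<^sub>j(1)\<close>, where \<open>\<chi>\<^sub>i\<close> runs through the irreducible characters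
of \<open>G\<close>, \<open>h\<^sub>i\<close> through class representatives of \<open>H\<close>, and dually for \<open>\<psi>\<^sub>j\<close> and \<open>g\<^sub>j\<close>. So every
\<open>h \<in> H\<close> names an irreducible character \<open>c h\<close> of \<open>G\<close>, every \<open>g \<in> G\<close> names an irreducible
character \<open>p g\<close> of \<open>H\<close>, and since the value of a character at an element equals its degree
exactly when the element lies in its kernel, \<open>g \<in> ker (c h)\<close> if and only if \<open>h \<in> ker (p g)\<close>. This
is a Galois connection: \<open>N\<^sup>T\<close> consists of the \<open>h\<close> with \<open>N \<subseteq> ker (c h)\<close>, equivalently it is the
intersection of the kernels of the \<open>p g\<close> with \<open>g \<in> N\<close>, hence normal. Normal subgroups are exactly
the intersections of kernels of irreducible characters, so all normal subgroups are closed on both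
sides, and the Galois connection is an anti-isomorphism of lattices.

For the orders, \<open>N\<^sup>T\<close> is a union of fibres of \<open>c\<close>, and \<open>|G/N|\<close> is the sum of the squared degrees
of the irreducible characters whose kernel contains \<open>N\<close>. So it suffices that the fibre of \<open>c\<close> over
\<open>\<chi>\<close> (a conjugacy class of \<open>H\<close>) has \<open>\<chi>(1)\<^sup>2\<close> elements. The sum over \<open>h \<in> H\<close> of \<open>p g h\<close> vanishes
unless \<open>p g\<close> is trivial, that is, unless \<open>g = 1\<close>. Translated to \<open>G\<close>: weighting each \<open>\<chi>\<close> with its
fibre size divided by \<open>\<chi>(1)\<close> yields a class function supported at \<open>1\<close>, that is, a multiple of the
regular character, in which \<open>\<chi>\<close> has weight \<open>\<chi>(1)\<close>. Comparing coefficients, fibre sizes are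
proportional to squared degrees, and the class \<open>{1}\<close> of \<open>H\<close>, which lies over the trivial
character, shows that the factor is one.

The character theory used is developed from matrices. Row orthogonality comes from Schur's lemma.
A representation is block triangular with respect to an invariant subspace, and traces see only the
diagonal blocks, so every character is a sum of irreducible ones; for the regular character,
orthogonality then determines the multiplicities. That a
character value equal to the degree forces the representing matrix to be the identity is the
equality case of the triangle inequality for roots of unity, followed by an argument for
unitriangular matrices of finite order.\<close>

section \<open>Traces and finite sums of matrices\<close>

definition mat_trace :: "'a::comm_monoid_add mat \<Rightarrow> 'a" where
  "mat_trace A = (\<Sum>i<dim_row A. A $$ (i, i))"

lemma mat_trace_mult_comm:
  fixes A B :: "'a::comm_semiring_0 mat"
  assumes "A \<in> carrier_mat n m" "B \<in> carrier_mat m n"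
  shows "mat_trace (A * B) = mat_trace (B * A)"
proof -
  have "mat_trace (A * B) = (\<Sum>i<n. \<Sum>j<m. A $$ (i, j) * B $$ (j, i))"
    using assms by (simp add: mat_trace_def scalar_prod_def atLeast0LessThan)
  also have "\<dots> = (\<Sum>j<m. \<Sum>i<n. B $$ (j, i) * A $$ (i, j))"
    by (subst sum.swap) (simp add: mult.commute)
  also have "\<dots> = mat_trace (B * A)"
    using assms by (simp add: mat_trace_def scalar_prod_def atLeast0LessThan)
  finally show ?thesis .
qed

lemma mat_trace_conjugate:
  fixes A :: "'a::comm_ring_1 mat"
  assumes "A \<in> carrier_mat n n" "F \<in> carrier_mat m n" "F' \<in> carrier_mat n m" "F' * F = 1\<^sub>m n"
  shows "mat_trace (F * A * F') = mat_trace A"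
proof -
  have "mat_trace (F * A * F') = mat_trace (F' * (F * A))"
    by (rule mat_trace_mult_comm) (use assms in auto)
  also have "F' * (F * A) = (F' * F) * A"
    by (rule assoc_mult_mat[symmetric]) (use assms in auto)
  finally show ?thesis using assms by simp
qed

text \<open>The dimensions are arguments because matrices of unspecified size have no zero to start a sum
with.\<close>

definition mat_sum :: "nat \<Rightarrow> nat \<Rightarrow> ('b \<Rightarrow> 'a::comm_monoid_add mat) \<Rightarrow> 'b set \<Rightarrow> 'a mat" where
  "mat_sum n m f S = mat n m (\<lambda>ij. \<Sum>s\<in>S. f s $$ ij)"

lemma mat_sum_carrier [simp]: "mat_sum n m f S \<in> carrier_mat n m"
  by (simp add: mat_sum_def)

lemma mat_sum_dim [simp]: "dim_row (mat_sum n m f S) = n" "dim_col (mat_sum n m f S) = m"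
  by (simp_all add: mat_sum_def)

lemma mat_sum_index [simp]:
  "i < n \<Longrightarrow> j < m \<Longrightarrow> mat_sum n m f S $$ (i, j) = (\<Sum>s\<in>S. f s $$ (i, j))"
  by (simp add: mat_sum_def)

lemma mult_mat_sum:
  fixes f :: "'b \<Rightarrow> 'a::semiring_0 mat"
  assumes "A \<in> carrier_mat k n" "\<And>s. s \<in> S \<Longrightarrow> f s \<in> carrier_mat n m"
  shows "A * mat_sum n m f S = mat_sum k m (\<lambda>s. A * f s) S"
proof (rule eq_matI)
  fix i j assume ij: "i < dim_row (mat_sum k m (\<lambda>s. A * f s) S)" "j < dim_col (mat_sum k m (\<lambda>s. A * f s) S)"
  have "(A * mat_sum n m f S) $$ (i, j) = (\<Sum>l<n. \<Sum>s\<in>S. A $$ (i, l) * f s $$ (l, j))"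
    using ij assms by (simp add: scalar_prod_def atLeast0LessThan sum_distrib_left)
  also have "\<dots> = (\<Sum>s\<in>S. \<Sum>l<n. A $$ (i, l) * f s $$ (l, j))"
    by (rule sum.swap)
  also have "\<dots> = (\<Sum>s\<in>S. (A * f s) $$ (i, j))"
    using ij assms(1) by (intro sum.cong refl) (use assms(2) in \<open>fastforce simp: scalar_prod_def atLeast0LessThan\<close>)
  finally show "(A * mat_sum n m f S) $$ (i, j) = mat_sum k m (\<lambda>s. A * f s) S $$ (i, j)"
    using ij by simp
qed (use assms in auto)

lemma mat_sum_mult:
  fixes f :: "'b \<Rightarrow> 'a::semiring_0 mat"
  assumes "A \<in> carrier_mat m k" "\<And>s. s \<in> S \<Longrightarrow> f s \<in> carrier_mat n m"
  shows "mat_sum n m f S * A = mat_sum n k (\<lambda>s. f s * A) S"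
proof (rule eq_matI)
  fix i j assume ij: "i < dim_row (mat_sum n k (\<lambda>s. f s * A) S)" "j < dim_col (mat_sum n k (\<lambda>s. f s * A) S)"
  have "(mat_sum n m f S * A) $$ (i, j) = (\<Sum>l<m. \<Sum>s\<in>S. f s $$ (i, l) * A $$ (l, j))"
    using ij assms by (simp add: scalar_prod_def atLeast0LessThan sum_distrib_right)
  also have "\<dots> = (\<Sum>s\<in>S. \<Sum>l<m. f s $$ (i, l) * A $$ (l, j))"
    by (rule sum.swap)
  also have "\<dots> = (\<Sum>s\<in>S. (f s * A) $$ (i, j))"
    using ij assms(1) by (intro sum.cong refl) (use assms(2) in \<open>fastforce simp: scalar_prod_def atLeast0LessThan\<close>)
  finally show "(mat_sum n m f S * A) $$ (i, j) = mat_sum n k (\<lambda>s. f s * A) S $$ (i, j)"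
    using ij by simp
qed (use assms in auto)

lemma mat_sum_reindex:
  assumes "bij_betw h S T" "\<And>s. s \<in> S \<Longrightarrow> f (h s) = g s"
  shows "mat_sum n m g S = mat_sum n m f T"
proof -
  have "(\<Sum>s\<in>S. g s $$ ij) = (\<Sum>t\<in>T. f t $$ ij)" for ij
    using sum.reindex_bij_betw[OF assms(1), of "\<lambda>t. f t $$ ij"] assms(2) by simp
  then show ?thesis by (simp add: mat_sum_def)
qed

lemma mat_sum_trace:
  assumes "\<And>s. s \<in> S \<Longrightarrow> f s \<in> carrier_mat n n"
  shows "mat_trace (mat_sum n n f S) = (\<Sum>s\<in>S. mat_trace (f s))"
proof -
  have "mat_trace (mat_sum n n f S) = (\<Sum>i<n. \<Sum>s\<in>S. f s $$ (i, i))"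
    by (simp add: mat_trace_def)
  also have "\<dots> = (\<Sum>s\<in>S. \<Sum>i<n. f s $$ (i, i))" by (rule sum.swap)
  also have "\<dots> = (\<Sum>s\<in>S. mat_trace (f s))"
    using assms by (intro sum.cong) (auto simp: mat_trace_def)
  finally show ?thesis .
qed

lemma mat_eqI_mult_vec:
  fixes A B :: "'a::semiring_1 mat"
  assumes "A \<in> carrier_mat n m" "B \<in> carrier_mat n m"
    and "\<And>v. v \<in> carrier_vec m \<Longrightarrow> A *\<^sub>v v = B *\<^sub>v v"
  shows "A = B"
proof (rule eq_matI)
  fix i j assume "i < dim_row B" "j < dim_col B"
  then show "A $$ (i, j) = B $$ (i, j)"
    using arg_cong[OF assms(3)[of "unit_vec m j"], of "\<lambda>v. v $ i"] assms(1,2) by simp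
qed (use assms in auto)

lemma mult_mat_vec_zero: "A \<in> carrier_mat n m \<Longrightarrow> A *\<^sub>v 0\<^sub>v m = (0\<^sub>v n :: complex vec)"
  by (intro eq_vecI) auto

text \<open>Sandwiching a matrix unit isolates the product of one entry of each factor. Averaging such
sandwiches over a group turns Schur's lemma into orthogonality relations between matrix entries.\<close>

lemma mult_matrix_unit_mult_index:
  fixes A B :: "'a::comm_semiring_1 mat"
  assumes A: "A \<in> carrier_mat n n" and B: "B \<in> carrier_mat m m" and "i < n" "a < n" "b < m" "j < m"
  shows "(A * mat n m (\<lambda>(k, l). if k = a \<and> l = b then 1 else 0) * B) $$ (i, j) = A $$ (i, a) * B $$ (b, j)"
proof -
  have "(A * mat n m (\<lambda>(k, l). if k = a \<and> l = b then 1 else 0)) $$ (i, l) = (if l = b then A $$ (i, a) else 0)"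
    if "l < m" for l
  proof -
    have "(A * mat n m (\<lambda>(k, l). if k = a \<and> l = b then 1 else 0)) $$ (i, l)
      = (\<Sum>k<n. A $$ (i, k) * (if k = a \<and> l = b then 1 else 0))"
      using that assms by (simp add: scalar_prod_def atLeast0LessThan)
    also have "\<dots> = (\<Sum>k<n. if k = a then (if l = b then A $$ (i, a) else 0) else 0)"
      by (rule sum.cong) auto
    also have "\<dots> = (if l = b then A $$ (i, a) else 0)" using assms by simp
    finally show ?thesis .
  qed
  then have "(A * mat n m (\<lambda>(k, l). if k = a \<and> l = b then 1 else 0) * B) $$ (i, j)
    = (\<Sum>l<m. (if l = b then A $$ (i, a) else 0) * B $$ (l, j))"
    using assms by (simp add: scalar_prod_def atLeast0LessThan)
  also have "\<dots> = (\<Sum>l<m. if l = b then A $$ (i, a) * B $$ (b, j) else 0)"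
    by (rule sum.cong) auto
  also have "\<dots> = A $$ (i, a) * B $$ (b, j)" using assms by simp
  finally show ?thesis .
qed

section \<open>Representations by complex matrices\<close>

text \<open>Invertibility is automatic for a multiplicative map that sends the identity to the identity: the
inverse of \<open>\<rho> g\<close> is \<open>\<rho> (inv g)\<close>.\<close>

lemma hom_GL_iff:
  fixes G (structure)
  assumes "group G"
  shows "\<rho> \<in> hom G (GL n) \<longleftrightarrow>
    (\<forall>g\<in>carrier G. \<rho> g \<in> carrier_mat n n) \<and>
    (\<forall>g\<in>carrier G. \<forall>h\<in>carrier G. \<rho> (g \<otimes>\<^bsub>G\<^esub> h) = \<rho> g * \<rho> h) \<and> \<rho> \<one>\<^bsub>G\<^esub> = 1\<^sub>m n"
proof -
  interpret group G by fact
  interpret R: ring "ring_mat TYPE(complex) n ()" by (rule ring_mat)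
  have GL: "group (GL n)" unfolding GL_def by (rule R.units_group)
  show ?thesis
  proof
    assume \<rho>: "\<rho> \<in> hom G (GL n)"
    interpret group_hom G "GL n" \<rho>
      by (rule group_hom.intro[OF assms GL]) (simp add: group_hom_axioms_def \<rho>)
    show "(\<forall>g\<in>carrier G. \<rho> g \<in> carrier_mat n n) \<and>
      (\<forall>g\<in>carrier G. \<forall>h\<in>carrier G. \<rho> (g \<otimes>\<^bsub>G\<^esub> h) = \<rho> g * \<rho> h) \<and> \<rho> \<one>\<^bsub>G\<^esub> = 1\<^sub>m n"
      using \<rho> hom_one
      by (auto simp: hom_def GL_def units_of_def Units_def ring_mat_simps)
  next
    assume a: "(\<forall>g\<in>carrier G. \<rho> g \<in> carrier_mat n n) \<and>
      (\<forall>g\<in>carrier G. \<forall>h\<in>carrier G. \<rho> (g \<otimes>\<^bsub>G\<^esub> h) = \<rho> g * \<rho> h) \<and> \<rho> \<one>\<^bsub>G\<^esub> = 1\<^sub>m n"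
    have "\<rho> g \<in> Units (ring_mat TYPE(complex) n ())" if g: "g \<in> carrier G" for g
    proof -
      have "\<rho> (inv g) * \<rho> g = 1\<^sub>m n" "\<rho> g * \<rho> (inv g) = 1\<^sub>m n"
        using a g by (metis inv_closed l_inv, metis inv_closed r_inv)
      then show ?thesis
        using a g by (auto simp: Units_def ring_mat_simps intro!: bexI[of _ "\<rho> (inv g)"])
    qed
    then show "\<rho> \<in> hom G (GL n)"
      using a by (auto simp: hom_def GL_def units_of_def ring_mat_simps)
  qed
qed

lemma subspace_module_vec_iff:
  "VectorSpace.subspace class_ring W (module_vec TYPE(complex) n) \<longleftrightarrow>
    W \<subseteq> carrier_vec n \<and> 0\<^sub>v n \<in> W \<and> (\<forall>v\<in>W. \<forall>w\<in>W. v + w \<in> W) \<and> (\<forall>c. \<forall>v\<in>W. c \<cdot>\<^sub>v v \<in> W)"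
proof -
  have vs: "vectorspace class_ring (module_vec TYPE(complex) n)" by (rule vec_vs)
  then have m: "Module.module class_ring (module_vec TYPE(complex) n)"
    by (simp add: vectorspace_def)
  show ?thesis
    using vs m unfolding VectorSpace.subspace_def submodule_def
    by (auto simp: module_vec_simps class_ring_simps)
qed

lemma irreducible_rep_invariant_subspace:
  assumes "group G" "irreducible_rep G n \<rho>"
    and "W \<subseteq> carrier_vec n" "0\<^sub>v n \<in> W"
    and "\<And>v w. v \<in> W \<Longrightarrow> w \<in> W \<Longrightarrow> v + w \<in> W"
    and "\<And>c v. v \<in> W \<Longrightarrow> c \<cdot>\<^sub>v v \<in> W"
    and "\<And>g w. g \<in> carrier G \<Longrightarrow> w \<in> W \<Longrightarrow> \<rho> g *\<^sub>v w \<in> W"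
  shows "W = {0\<^sub>v n} \<or> W = carrier_vec n"
proof -
  have "VectorSpace.subspace class_ring W (module_vec TYPE(complex) n)"
    using assms(3-6) by (simp add: subspace_module_vec_iff)
  then show ?thesis
    using assms(2,7) unfolding irreducible_rep_def by simp
qed

lemma irreducible_repD:
  assumes "group G" "irreducible_rep G n \<rho>"
  shows "\<rho> \<in> hom G (GL n)" "n > 0"
    "\<And>g. g \<in> carrier G \<Longrightarrow> \<rho> g \<in> carrier_mat n n"
    "\<And>g h. g \<in> carrier G \<Longrightarrow> h \<in> carrier G \<Longrightarrow> \<rho> (g \<otimes>\<^bsub>G\<^esub> h) = \<rho> g * \<rho> h"
    "\<rho> \<one>\<^bsub>G\<^esub> = 1\<^sub>m n"
  using assms(2) hom_GL_iff[OF assms(1), of \<rho> n] unfolding irreducible_rep_def by auto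

section \<open>Schur's lemma and row orthogonality\<close>

lemma (in group) bij_betw_lmult:
  assumes "h \<in> carrier G"
  shows "bij_betw (\<lambda>g. h \<otimes> g) (carrier G) (carrier G)"
  by (rule bij_betw_byWitness[where f' = "\<lambda>g. inv h \<otimes> g"])
     (use assms in \<open>auto simp: m_assoc[symmetric]\<close>)

text \<open>Schur's lemma: kernel and image of an intertwiner are invariant subspaces, hence trivial, which
leaves only the zero map and bijections.\<close>

lemma schur_zero_or_invertible:
  assumes G: "group G" and \<rho>: "irreducible_rep G n \<rho>" and \<sigma>: "irreducible_rep G m \<sigma>"
    and F: "F \<in> carrier_mat n m"
    and comm: "\<And>g. g \<in> carrier G \<Longrightarrow> \<rho> g * F = F * \<sigma> g"
  shows "F = 0\<^sub>m n m \<or> (\<exists>F'\<in>carrier_mat m n. F * F' = 1\<^sub>m n \<and> F' * F = 1\<^sub>m m)"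
proof -
  note [simp] = F irreducible_repD(3)[OF G \<rho>] irreducible_repD(3)[OF G \<sigma>]
  have comm_vec: "\<rho> g *\<^sub>v (F *\<^sub>v v) = F *\<^sub>v (\<sigma> g *\<^sub>v v)"
    if "g \<in> carrier G" "v \<in> carrier_vec m" for g v
    using comm[OF that(1)] assoc_mult_mat_vec[OF irreducible_repD(3)[OF G \<rho> that(1)] F that(2)]
      assoc_mult_mat_vec[OF F irreducible_repD(3)[OF G \<sigma> that(1)] that(2)] by simp
  define K where "K = {v \<in> carrier_vec m. F *\<^sub>v v = 0\<^sub>v n}"
  define I where "I = {F *\<^sub>v v | v. v \<in> carrier_vec m}"
  have K: "K = {0\<^sub>v m} \<or> K = carrier_vec m"
  proof (rule irreducible_rep_invariant_subspace[OF G \<sigma>])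
    show "\<sigma> g *\<^sub>v w \<in> K" if "g \<in> carrier G" "w \<in> K" for g w
    proof -
      have "F *\<^sub>v (\<sigma> g *\<^sub>v w) = \<rho> g *\<^sub>v (F *\<^sub>v w)"
        using that comm_vec[of g w] by (simp add: K_def)
      also have "\<dots> = 0\<^sub>v n"
        using that mult_mat_vec_zero[OF irreducible_repD(3)[OF G \<rho>]] by (simp add: K_def)
      finally show ?thesis
        using that mult_mat_vec_carrier[OF irreducible_repD(3)[OF G \<sigma>]] by (simp add: K_def)
    qed
  qed (auto simp: K_def mult_add_distrib_mat_vec[OF F] mult_mat_vec[OF F] mult_mat_vec_zero[OF F])
  have I: "I = {0\<^sub>v n} \<or> I = carrier_vec n"
  proof (rule irreducible_rep_invariant_subspace[OF G \<rho>])
    show "0\<^sub>v n \<in> I"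
      unfolding I_def by (intro CollectI exI[of _ "0\<^sub>v m"]) (auto simp: mult_mat_vec_zero[OF F])
    show "v + w \<in> I" if vw: "v \<in> I" "w \<in> I" for v w
    proof -
      obtain a b where ab: "v = F *\<^sub>v a" "a \<in> carrier_vec m" "w = F *\<^sub>v b" "b \<in> carrier_vec m"
        using vw unfolding I_def by blast
      then show ?thesis unfolding I_def
        by (intro CollectI exI[of _ "a + b"]) (simp add: mult_add_distrib_mat_vec[OF F])
    qed
    show "c \<cdot>\<^sub>v v \<in> I" if vw: "v \<in> I" for c v
    proof -
      obtain a where ab: "v = F *\<^sub>v a" "a \<in> carrier_vec m"
        using vw unfolding I_def by blast
      then show ?thesis unfolding I_def
        by (intro CollectI exI[of _ "c \<cdot>\<^sub>v a"]) (simp add: mult_mat_vec[OF F])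
    qed
    show "\<rho> g *\<^sub>v w \<in> I" if vw: "g \<in> carrier G" "w \<in> I" for g w
    proof -
      obtain a where a: "w = F *\<^sub>v a" "a \<in> carrier_vec m"
        using vw unfolding I_def by blast
      moreover have "\<sigma> g *\<^sub>v a \<in> carrier_vec m"
        using a vw mult_mat_vec_carrier[OF irreducible_repD(3)[OF G \<sigma>]] by simp
      ultimately show ?thesis unfolding I_def
        using comm_vec[OF vw(1) a(2)] by auto
    qed
  qed (auto simp: I_def mult_mat_vec_carrier[OF F])
  show ?thesis
  proof (cases "K = carrier_vec m \<or> I = {0\<^sub>v n}")
    case True
    then have "F *\<^sub>v v = 0\<^sub>v n" if "v \<in> carrier_vec m" for v
      using that by (auto simp: K_def I_def)
    then have "F = 0\<^sub>m n m"
      by (intro mat_eqI_mult_vec[of _ n m]) auto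
    then show ?thesis ..
  next
    case False
    then have K0: "K = {0\<^sub>v m}" and I1: "I = carrier_vec n" using K I by auto
    have "\<exists>v. v \<in> carrier_vec m \<and> F *\<^sub>v v = unit_vec n j" for j
    proof -
      have "unit_vec n j \<in> I" unfolding I1 by simp
      then show ?thesis unfolding I_def by (auto dest: sym)
    qed
    then obtain v where v: "\<And>j. v j \<in> carrier_vec m" "\<And>j. F *\<^sub>v v j = unit_vec n j"
      by metis
\<comment> \<open>The columns of the inverse are preimages of the unit vectors. As \<open>n = m\<close> is not yet known,
  injectivity has to show that this right inverse is also a left inverse.\<close>
    define F' where "F' = mat_of_cols m (map v [0..<n])"
    have F': "F' \<in> carrier_mat m n" by (simp add: F'_def mat_of_cols_def)
    have FF': "F * F' = 1\<^sub>m n"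
    proof (rule mat_col_eqI)
      fix j assume j: "j < dim_col (1\<^sub>m n :: complex mat)"
      have "col F' j = v j" using j v(1) by (simp add: F'_def col_mat_of_cols)
      then show "col (F * F') j = col (1\<^sub>m n) j"
        using j v(2)[of j] F' by (simp add: col_mult2[OF F F'])
    qed (use F' in \<open>auto simp: carrier_matD[OF F]\<close>)
    have "F' * F = 1\<^sub>m m"
    proof (rule mat_eqI_mult_vec[of _ m m])
      fix w :: "complex vec" assume w: "w \<in> carrier_vec m"
      have Fw: "F *\<^sub>v w \<in> carrier_vec n" using w by (rule mult_mat_vec_carrier[OF F])
      have u: "F' * F *\<^sub>v w \<in> carrier_vec m"
        using w by (rule mult_mat_vec_carrier[OF mult_carrier_mat[OF F' F]])
      have "F *\<^sub>v (F' * F *\<^sub>v w) = F * F' *\<^sub>v (F *\<^sub>v w)"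
        by (simp only: assoc_mult_mat_vec[OF F' F w] assoc_mult_mat_vec[OF F F' Fw])
      then have "F *\<^sub>v (F' * F *\<^sub>v w) = F *\<^sub>v w" using FF' Fw by simp
      then have "F' * F *\<^sub>v w - w \<in> K"
        using w u mult_mat_vec_carrier[OF F w] by (simp add: K_def mult_minus_distrib_mat_vec[OF F u w])
      then have z: "F' * F *\<^sub>v w - w = 0\<^sub>v m" using K0 by simp
      show "F' * F *\<^sub>v w = 1\<^sub>m m *\<^sub>v w"
      proof (rule eq_vecI)
        fix i assume "i < dim_vec (1\<^sub>m m *\<^sub>v w)"
        then show "(F' * F *\<^sub>v w) $ i = (1\<^sub>m m *\<^sub>v w) $ i"
          using arg_cong[OF z, of "\<lambda>v. v $ i"] w u by auto
      qed (use F' in auto)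
    qed (use F' in \<open>auto simp: carrier_matD[OF F]\<close>)
    then show ?thesis using F' FF' by blast
  qed
qed

lemma complex_eigenvector_exists:
  assumes A: "(A :: complex mat) \<in> carrier_mat n n" and "n > 0"
  shows "\<exists>c v. v \<in> carrier_vec n \<and> v \<noteq> 0\<^sub>v n \<and> A *\<^sub>v v = c \<cdot>\<^sub>v v"
proof -
  have "degree (char_poly A) > 0" using degree_monic_char_poly[OF A] assms(2) by simp
  then have "\<not> constant (poly (char_poly A))" by (simp add: constant_degree)
  then obtain c where "poly (char_poly A) c = 0"
    using fundamental_theorem_of_algebra by blast
  then have "eigenvalue A c" using eigenvalue_root_char_poly[OF A] by simp
  then show ?thesis using A by (auto simp: eigenvalue_def eigenvector_def)
qed

text \<open>Over the complex numbers an endomorphism has an eigenvalue, and its eigenspace is an invariant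
subspace.\<close>

lemma schur_scalar:
  assumes G: "group G" and \<rho>: "irreducible_rep G n \<rho>"
    and F: "F \<in> carrier_mat n n"
    and comm: "\<And>g. g \<in> carrier G \<Longrightarrow> \<rho> g * F = F * \<rho> g"
  shows "\<exists>c. F = c \<cdot>\<^sub>m 1\<^sub>m n"
proof -
  note \<rho>c = irreducible_repD(3)[OF G \<rho>]
  obtain c u where u: "u \<in> carrier_vec n" "u \<noteq> 0\<^sub>v n" "F *\<^sub>v u = c \<cdot>\<^sub>v u"
    using complex_eigenvector_exists[OF F irreducible_repD(2)[OF G \<rho>]] by auto
  define W where "W = {v \<in> carrier_vec n. F *\<^sub>v v = c \<cdot>\<^sub>v v}"
  have "W = {0\<^sub>v n} \<or> W = carrier_vec n"
  proof (rule irreducible_rep_invariant_subspace[OF G \<rho>])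
    show "\<rho> g *\<^sub>v w \<in> W" if g: "g \<in> carrier G" and "w \<in> W" for g w
    proof -
      have w: "w \<in> carrier_vec n" "F *\<^sub>v w = c \<cdot>\<^sub>v w" using \<open>w \<in> W\<close> by (auto simp: W_def)
      have "F *\<^sub>v (\<rho> g *\<^sub>v w) = \<rho> g *\<^sub>v (F *\<^sub>v w)"
        using comm[OF g] assoc_mult_mat_vec[OF F \<rho>c[OF g] w(1)]
          assoc_mult_mat_vec[OF \<rho>c[OF g] F w(1)] by simp
      also have "\<dots> = c \<cdot>\<^sub>v (\<rho> g *\<^sub>v w)"
        unfolding w(2) by (rule mult_mat_vec[OF \<rho>c[OF g] w(1)])
      finally show ?thesis using w(1) \<rho>c[OF g] by (auto simp: W_def)
    qed
    show "0\<^sub>v n \<in> W" using F by (auto simp: W_def)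
    show "v + w \<in> W" if "v \<in> W" "w \<in> W" for v w
      using that F by (auto simp: W_def mult_add_distrib_mat_vec[OF F] smult_add_distrib_vec[of _ n])
    show "k \<cdot>\<^sub>v v \<in> W" if "v \<in> W" for k v
      using that F by (auto simp: W_def mult_mat_vec[OF F] smult_smult_assoc mult.commute)
  qed (auto simp: W_def)
  then have "W = carrier_vec n" using u by (auto simp: W_def)
  then have "F *\<^sub>v v = c \<cdot>\<^sub>v v" if "v \<in> carrier_vec n" for v
    using that by (auto simp: W_def)
  moreover have "(c \<cdot>\<^sub>m 1\<^sub>m n) *\<^sub>v v = c \<cdot>\<^sub>v v" if "v \<in> carrier_vec n" for v
    using that by (intro eq_vecI) (auto simp: row_smult)
  ultimately have "F = c \<cdot>\<^sub>m 1\<^sub>m n"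
    using F by (intro mat_eqI_mult_vec[of _ n n]) auto
  then show ?thesis ..
qed

lemma (in group) intertwiner_average:
  assumes \<rho>: "irreducible_rep G n \<rho>" and \<sigma>: "irreducible_rep G m \<sigma>" and E: "E \<in> carrier_mat n m"
    and h: "h \<in> carrier G"
  defines "F \<equiv> mat_sum n m (\<lambda>g. \<rho> g * E * \<sigma> (inv g)) (carrier G)"
  shows "\<rho> h * F = F * \<sigma> h"
proof -
  note [simp] = irreducible_repD(3)[OF group_axioms \<rho>] irreducible_repD(3)[OF group_axioms \<sigma>]
  have t: "\<rho> g * E * \<sigma> (inv g) \<in> carrier_mat n m" if "g \<in> carrier G" for g
    by (rule mult_carrier_mat[OF mult_carrier_mat[OF _ E]]) (use that in auto)
  have "\<rho> h * F = mat_sum n m (\<lambda>g. \<rho> h * (\<rho> g * E * \<sigma> (inv g))) (carrier G)"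
    unfolding F_def by (rule mult_mat_sum) (use h t in auto)
  also have "\<dots> = mat_sum n m (\<lambda>g. \<rho> g * E * \<sigma> (inv g) * \<sigma> h) (carrier G)"
  proof (rule mat_sum_reindex[OF bij_betw_lmult[OF h]])
    fix g assume g: "g \<in> carrier G"
    have *: "inv (h \<otimes> g) \<otimes> h = inv g"
      using g h by (simp add: inv_mult_group m_assoc)
    have \<rho>E: "\<rho> x * E \<in> carrier_mat n m" if "x \<in> carrier G" for x
      using that E by (intro mult_carrier_mat[of _ n n]) auto
    have "\<rho> (h \<otimes> g) * E * \<sigma> (inv (h \<otimes> g)) * \<sigma> h = \<rho> (h \<otimes> g) * E * (\<sigma> (inv (h \<otimes> g)) * \<sigma> h)"
      by (rule assoc_mult_mat[of _ n m _ m _ m]) (use g h \<rho>E in auto)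
    also have "\<dots> = \<rho> h * \<rho> g * E * \<sigma> (inv g)"
      using irreducible_repD(4)[OF group_axioms \<sigma>, of "inv (h \<otimes> g)" h]
        irreducible_repD(4)[OF group_axioms \<rho>, of h g] g h * by simp
    also have "\<dots> = \<rho> h * (\<rho> g * E) * \<sigma> (inv g)"
      using g h E by (simp add: assoc_mult_mat[of _ n n _ n _ m])
    also have "\<dots> = \<rho> h * (\<rho> g * E * \<sigma> (inv g))"
      by (rule assoc_mult_mat[of _ n n _ m _ m]) (use g h \<rho>E in auto)
    finally show "\<rho> (h \<otimes> g) * E * \<sigma> (inv (h \<otimes> g)) * \<sigma> h = \<rho> h * (\<rho> g * E * \<sigma> (inv g))" .
  qed
  also have "\<dots> = F * \<sigma> h"
    unfolding F_def by (rule mat_sum_mult[symmetric]) (use h t in auto)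
  finally show ?thesis .
qed

lemma rep_character_eq_trace:
  assumes "group G" "\<rho> \<in> hom G (GL n)" "g \<in> carrier G"
  shows "rep_character G n \<rho> g = mat_trace (\<rho> g)"
proof -
  have "\<rho> g \<in> carrier_mat n n" using assms by (simp add: hom_GL_iff)
  then show ?thesis using assms(3) by (simp add: rep_character_def mat_trace_def)
qed

lemma (in group) character_pairing_as_intertwiners:
  assumes \<rho>: "irreducible_rep G n \<rho>" and \<sigma>: "irreducible_rep G m \<sigma>"
  shows "(\<Sum>g\<in>carrier G. rep_character G n \<rho> g * rep_character G m \<sigma> (inv g)) =
    (\<Sum>i<n. \<Sum>j<m. mat_sum n m
       (\<lambda>g. \<rho> g * mat n m (\<lambda>(k, l). if k = i \<and> l = j then 1 else 0) * \<sigma> (inv g)) (carrier G) $$ (i, j))"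
proof -
  have "(\<Sum>g\<in>carrier G. rep_character G n \<rho> g * rep_character G m \<sigma> (inv g))
    = (\<Sum>g\<in>carrier G. \<Sum>i<n. \<Sum>j<m. \<rho> g $$ (i, i) * \<sigma> (inv g) $$ (j, j))"
    by (intro sum.cong) (auto simp: rep_character_def sum_product)
  also have "\<dots> = (\<Sum>i<n. \<Sum>j<m. \<Sum>g\<in>carrier G. \<rho> g $$ (i, i) * \<sigma> (inv g) $$ (j, j))"
    by (subst sum.swap) (intro sum.cong refl sum.swap)
  also have "\<dots> = (\<Sum>i<n. \<Sum>j<m. mat_sum n m
       (\<lambda>g. \<rho> g * mat n m (\<lambda>(k, l). if k = i \<and> l = j then 1 else 0) * \<sigma> (inv g)) (carrier G) $$ (i, j))"
    using irreducible_repD(3)[OF group_axioms \<rho>] irreducible_repD(3)[OF group_axioms \<sigma>]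
    by (intro sum.cong refl) (simp add: mult_matrix_unit_mult_index)
  finally show ?thesis .
qed

text \<open>For different characters every averaged matrix unit is zero, since an invertible intertwiner would
make the two traces agree. For equal characters it is a scalar matrix, and the scalar can be
read off from the trace, which averaging multiplies by the group order.\<close>

theorem (in group) irr_chars_orthogonality:
  assumes "\<chi> \<in> irr_chars G" "\<psi> \<in> irr_chars G"
  shows "(\<Sum>g\<in>carrier G. \<chi> g * \<psi> (inv g)) = (if \<chi> = \<psi> then of_nat (card (carrier G)) else 0)"
proof (cases "\<chi> = \<psi>")
  case False
  obtain n \<rho> m \<sigma> where \<rho>: "irreducible_rep G n \<rho>" "\<chi> = rep_character G n \<rho>"
    and \<sigma>: "irreducible_rep G m \<sigma>" "\<psi> = rep_character G m \<sigma>"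
    using assms by (auto simp: irr_chars_def)
  have "mat_sum n m (\<lambda>g. \<rho> g * E * \<sigma> (inv g)) (carrier G) = 0\<^sub>m n m"
    if E: "E \<in> carrier_mat n m" for E
  proof (rule ccontr)
    define F where "F = mat_sum n m (\<lambda>g. \<rho> g * E * \<sigma> (inv g)) (carrier G)"
    have F: "F \<in> carrier_mat n m" by (simp add: F_def)
    assume "mat_sum n m (\<lambda>g. \<rho> g * E * \<sigma> (inv g)) (carrier G) \<noteq> 0\<^sub>m n m"
    then have "F \<noteq> 0\<^sub>m n m" by (simp add: F_def)
    moreover have comm: "\<rho> g * F = F * \<sigma> g" if "g \<in> carrier G" for g
      unfolding F_def by (rule intertwiner_average[OF \<rho>(1) \<sigma>(1) E that])
    ultimately obtain F' where F': "F' \<in> carrier_mat m n" "F * F' = 1\<^sub>m n" "F' * F = 1\<^sub>m m"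
      using schur_zero_or_invertible[OF group_axioms \<rho>(1) \<sigma>(1) F] by blast
    have "\<chi> g = \<psi> g" if g: "g \<in> carrier G" for g
    proof -
      note c = irreducible_repD(3)[OF group_axioms \<rho>(1) g] irreducible_repD(3)[OF group_axioms \<sigma>(1) g]
      have "\<rho> g = \<rho> g * (F * F')" using F' c by simp
      also have "\<dots> = F * \<sigma> g * F'"
        using comm[OF g] assoc_mult_mat[OF c(1) F F'(1)] by simp
      finally have "mat_trace (\<rho> g) = mat_trace (\<sigma> g)"
        using mat_trace_conjugate[OF c(2) F F'(1) F'(3)] by simp
      then show ?thesis
        using g \<rho> \<sigma> irreducible_repD(1)[OF group_axioms] by (simp add: rep_character_eq_trace[OF group_axioms])
    qed
    then have "\<chi> = \<psi>"
      unfolding \<rho>(2) \<sigma>(2) rep_character_def by (auto simp: fun_eq_iff restrict_def)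
    then show False using False by simp
  qed
  then show ?thesis
    using False unfolding \<rho>(2) \<sigma>(2) character_pairing_as_intertwiners[OF \<rho>(1) \<sigma>(1)]
    by (simp add: mat_sum_def)
next
  case True
  obtain n \<rho> where \<rho>: "irreducible_rep G n \<rho>" "\<chi> = rep_character G n \<rho>"
    using assms by (auto simp: irr_chars_def)
  note n0 = irreducible_repD(2)[OF group_axioms \<rho>(1)]
  note c = irreducible_repD(3)[OF group_axioms \<rho>(1)]
  define E where "E i j = mat n n (\<lambda>(k, l). if k = i \<and> l = j then 1 else (0::complex))" for i j
  define F where "F i j = mat_sum n n (\<lambda>g. \<rho> g * E i j * \<rho> (inv g)) (carrier G)" for i j
  have E: "E i j \<in> carrier_mat n n" for i j by (simp add: E_def)
  have F: "F i j \<in> carrier_mat n n" for i j by (simp add: F_def)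
  have entry: "F i j $$ (i, j) = (if i = j then of_nat (card (carrier G)) / of_nat n else 0)"
    if i: "i < n" and j: "j < n" for i j
  proof -
    have "\<rho> g * F i j = F i j * \<rho> g" if "g \<in> carrier G" for g
      unfolding F_def by (rule intertwiner_average[OF \<rho>(1) \<rho>(1) E that])
    then obtain k where k: "F i j = k \<cdot>\<^sub>m 1\<^sub>m n"
      using schur_scalar[OF group_axioms \<rho>(1) F] by blast
    have "mat_trace (F i j) = (\<Sum>g\<in>carrier G. mat_trace (\<rho> g * E i j * \<rho> (inv g)))"
      unfolding F_def
      by (rule mat_sum_trace) (rule mult_carrier_mat[OF mult_carrier_mat[OF c E] c], auto)
    also have "\<dots> = (\<Sum>g\<in>carrier G. mat_trace (E i j))"
    proof (rule sum.cong[OF refl])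
      fix g assume g: "g \<in> carrier G"
      have "\<rho> (inv g) * \<rho> g = 1\<^sub>m n"
        using irreducible_repD(4)[OF group_axioms \<rho>(1), of "inv g" g] g
          irreducible_repD(5)[OF group_axioms \<rho>(1)] by simp
      then show "mat_trace (\<rho> g * E i j * \<rho> (inv g)) = mat_trace (E i j)"
        using g c E by (intro mat_trace_conjugate[of _ n _ n]) auto
    qed
    also have "mat_trace (E i j) = (\<Sum>k<n. if k = i then (if i = j then 1 else 0) else 0)"
      by (auto simp: mat_trace_def E_def intro!: sum.cong)
    also have "\<dots> = (if i = j then 1 else 0)" using i by simp
    finally have "mat_trace (F i j) = (if i = j then of_nat (card (carrier G)) else 0)" by simp
    moreover have "mat_trace (F i j) = of_nat n * k" by (simp add: k mat_trace_def)
    ultimately have "k = (if i = j then of_nat (card (carrier G)) / of_nat n else 0)"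
      using n0 by (auto simp: field_simps split: if_splits)
    then show ?thesis using i j by (simp add: k)
  qed
  have "(\<Sum>g\<in>carrier G. \<chi> g * \<chi> (inv g)) = (\<Sum>i<n. \<Sum>j<n. F i j $$ (i, j))"
    unfolding \<rho>(2) character_pairing_as_intertwiners[OF \<rho>(1) \<rho>(1)] F_def E_def ..
  also have "\<dots> = (\<Sum>i<n. \<Sum>j<n. if i = j then of_nat (card (carrier G)) / of_nat n else 0)"
    by (intro sum.cong refl) (use entry in auto)
  also have "\<dots> = of_nat (card (carrier G))" using n0 by simp
  finally show ?thesis using True by simp
qed

section \<open>The regular character\<close>

text \<open>A basis of \<open>W\<close> extended to a basis of the whole space: the columns of \<open>P\<close> are the basis vectors,
those of index below \<open>k\<close> span \<open>W\<close>, and \<open>Q\<close> computes coordinates.\<close>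

lemma adapted_basis_matrix:
  fixes W :: "complex vec set"
  assumes W: "VectorSpace.subspace class_ring W (module_vec TYPE(complex) n)"
    and "W \<noteq> {0\<^sub>v n}" "W \<noteq> carrier_vec n"
  obtains P Q k where "P \<in> carrier_mat n n" "Q \<in> carrier_mat n n" "P * Q = 1\<^sub>m n" "Q * P = 1\<^sub>m n"
    "0 < k" "k < n" "\<And>j. j < k \<Longrightarrow> col P j \<in> W"
    "\<And>w i. w \<in> W \<Longrightarrow> k \<le> i \<Longrightarrow> i < n \<Longrightarrow> (Q *\<^sub>v w) $ i = 0"
proof -
  interpret vec_space "TYPE(complex)" n .
  have Wc: "W \<subseteq> carrier_vec n" using W by (simp add: subspace_module_vec_iff)
  have sub: "submodule class_ring W V" using W by (simp add: VectorSpace.subspace_def)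
  have "\<exists>B. finite B \<and> maximal B (\<lambda>S. S \<subseteq> W \<and> lin_indpt S)"
  proof (rule maximal_exists)
    show "finite A \<and> card A \<le> n" if "A \<subseteq> W \<and> lin_indpt A" for A
      using li_le_dim[OF fin_dim, of A] that Wc dim_is_n by auto
    show "{} \<subseteq> W \<and> lin_indpt {}" by (auto simp: lin_dep_def)
  qed
  then obtain B where B: "finite B" "B \<subseteq> W" "lin_indpt B"
    and Bmax: "\<And>S. S \<subseteq> W \<Longrightarrow> lin_indpt S \<Longrightarrow> B \<subseteq> S \<Longrightarrow> S = B"
    by (auto simp: maximal_def)
  have Bc: "B \<subseteq> carrier_vec n" using B Wc by auto
  have "W \<subseteq> span B"
  proof
    fix w assume w: "w \<in> W"
    show "w \<in> span B"
    proof (rule ccontr)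
      assume nw: "w \<notin> span B"
      then have "w \<notin> B" using in_own_span[of B] Bc by auto
      moreover have "lin_indpt (B \<union> {w})"
        using lin_dep_iff_in_span[of B w] nw \<open>w \<notin> B\<close> B Bc w Wc by auto
      ultimately show False using Bmax[of "B \<union> {w}"] B w by auto
    qed
  qed
  moreover have "span B \<subseteq> W" by (rule span_is_subset[OF B(2) sub])
  ultimately have span: "span B = W" by auto
  define k where "k = card B"
  have k0: "k > 0"
  proof (rule ccontr)
    assume "\<not> k > 0"
    then have "B = {}" using B by (simp add: k_def)
    then show False using span assms(2) by (simp add: span_empty)
  qed
  have kn: "k < n"
  proof (rule ccontr)
    assume "\<not> k < n"
    then have "basis B" using dim_li_is_basis[OF fin_dim B(1)] Bc B(3) by (simp add: k_def dim_is_n)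
    then show False using span assms(3) by (simp add: basis_def)
  qed
  have "B \<subseteq> span (set (unit_vecs n))" using Bc by (simp add: span_unit_vecs_is_carrier)
  moreover have "set (unit_vecs n) \<subseteq> carrier_vec n" by (rule unit_vecs_carrier)
  ultimately obtain C where C: "finite C" "C \<subseteq> carrier_vec n" "C \<inter> B = {}"
    "int (card C) \<le> int (card (set (unit_vecs n :: complex vec list))) - int (card B)"
    "span (B \<union> C) = span (set (unit_vecs n))"
    using replacement[OF B(1) finite_set[of "unit_vecs n"] _ B(3)] by (auto simp: span_unit_vecs_is_carrier)
  have spanBC: "span (B \<union> C) = carrier_vec n" using C(5) by (simp add: span_unit_vecs_is_carrier)
  have cardC_le: "card C \<le> n - k"
    using C(4) kn distinct_card[of "unit_vecs n :: complex vec list"]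
    by (simp add: k_def unit_vecs_distinct)
  have "card (B \<union> C) \<ge> n"
    using gen_ge_dim[of "B \<union> C"] B Bc C spanBC by (simp add: dim_is_n)
  moreover have cardBC: "card (B \<union> C) = k + card C"
    unfolding k_def by (rule card_Un_disjoint) (use B C in auto)
  ultimately have cardC: "card C = n - k" using cardC_le by simp
  obtain bs cs where bs: "set bs = B" "distinct bs" and cs: "set cs = C" "distinct cs"
    using B(1) C(1) finite_distinct_list by metis
  have lbs: "length bs = k" and lcs: "length cs = n - k"
    using distinct_card[OF bs(2)] distinct_card[OF cs(2)] bs(1) cs(1) cardC by (simp_all add: k_def)
  define P where "P = mat_of_cols n (bs @ cs)"
  have P: "P \<in> carrier_mat n n" using lbs lcs kn by (simp add: P_def mat_of_cols_def)
  have colsP: "set (cols P) = B \<union> C"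
    using bs cs Bc C by (simp add: P_def cols_mat_of_cols)
  have surj: "\<exists>x\<in>carrier_vec n. P *\<^sub>v x = v" if "v \<in> carrier_vec n" for v
  proof -
    have "v \<in> col_space P" using that spanBC by (simp add: col_space_def colsP)
    then show ?thesis using col_space_eq[OF P] P by auto
  qed
  have "\<exists>x. x \<in> carrier_vec n \<and> P *\<^sub>v x = unit_vec n j" for j using surj[of "unit_vec n j"] by auto
  then obtain x where x: "\<And>j. x j \<in> carrier_vec n" "\<And>j. P *\<^sub>v x j = unit_vec n j" by metis
  define Q where "Q = mat_of_cols n (map x [0..<n])"
  have Q: "Q \<in> carrier_mat n n" by (simp add: Q_def mat_of_cols_def)
  have PQ: "P * Q = 1\<^sub>m n"
  proof (rule mat_col_eqI)
    fix j assume j: "j < dim_col (1\<^sub>m n :: complex mat)"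
    have "col Q j = x j" using j x(1) by (simp add: Q_def col_mat_of_cols)
    then show "col (P * Q) j = col (1\<^sub>m n) j"
      using j x(2)[of j] Q by (simp add: col_mult2[OF P Q])
  qed (use P Q in auto)
  have QP: "Q * P = 1\<^sub>m n" using mat_mult_left_right_inverse[OF P Q PQ] .
  have colB: "col P j \<in> W" if "j < k" for j
  proof -
    have "(bs @ cs) ! j = bs ! j" using that lbs by (simp add: nth_append)
    moreover have "bs ! j \<in> B" using that lbs bs by auto
    moreover have "col P j = (bs @ cs) ! j"
      unfolding P_def by (rule col_mat_of_cols) (use calculation that lbs Bc in auto)
    ultimately show ?thesis using B(2) by auto
  qed
  have zero: "(Q *\<^sub>v w) $ i = 0" if w: "w \<in> W" and i: "k \<le> i" "i < n" for w i
  proof -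
    define PB where "PB = mat_of_cols n bs"
    have PB: "PB \<in> carrier_mat n k" using lbs by (simp add: PB_def mat_of_cols_def)
    have "set (cols PB) = B" using bs Bc by (simp add: PB_def cols_mat_of_cols)
    then have "w \<in> col_space PB" using w span by (simp add: col_space_def)
    then obtain y where y: "y \<in> carrier_vec k" "PB *\<^sub>v y = w" using col_space_eq[OF PB] PB by auto
    define z where "z = vec n (\<lambda>i. if i < k then y $ i else 0)"
    have "P *\<^sub>v z = w"
    proof (rule eq_vecI)
      fix l assume "l < dim_vec w"
      then have l: "l < n" using w Wc by auto
      have "(P *\<^sub>v z) $ l = (\<Sum>j<n. P $$ (l, j) * (if j < k then y $ j else 0))"
        using l P by (simp add: z_def scalar_prod_def atLeast0LessThan)
      also have "\<dots> = (\<Sum>j<k. P $$ (l, j) * y $ j)"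
        using kn by (intro sum.mono_neutral_cong_right) auto
      also have "\<dots> = (\<Sum>j<k. PB $$ (l, j) * y $ j)"
        using l lbs lcs kn by (intro sum.cong refl) (simp add: P_def PB_def mat_of_cols_def nth_append)
      also have "\<dots> = (PB *\<^sub>v y) $ l"
        using l PB y(1) by (simp add: scalar_prod_def atLeast0LessThan)
      finally show "(P *\<^sub>v z) $ l = w $ l" using y by simp
    qed (use P w Wc in auto)
    then have "Q *\<^sub>v w = Q * P *\<^sub>v z" using P Q by (simp add: assoc_mult_mat_vec[of _ n n _ n] z_def)
    then have "Q *\<^sub>v w = z" using QP by (simp add: z_def)
    then show ?thesis using i by (simp add: z_def)
  qed
  show thesis by (rule that[OF P Q PQ QP k0 kn colB zero])
qed

text \<open>Induction on the degree. In a basis adapted to an invariant subspace all matrices are block upper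
triangular; the diagonal blocks are again representations, and their traces add up to the given
character.\<close>

lemma (in group) character_sum_of_irr_chars:
  assumes "R \<in> hom G (GL n)"
  shows "\<exists>cs. set cs \<subseteq> irr_chars G \<and> (\<forall>g\<in>carrier G. mat_trace (R g) = (\<Sum>\<chi>\<leftarrow>cs. \<chi> g))"
  using assms
proof (induction n arbitrary: R rule: less_induct)
  case (less n R)
  note R = less.prems[unfolded hom_GL_iff[OF group_axioms]]
  have Rc: "R g \<in> carrier_mat n n" if "g \<in> carrier G" for g using R that by blast
  consider "n = 0" | "irreducible_rep G n R" | "n > 0" "\<not> irreducible_rep G n R" by blast
  then show ?case
  proof cases
    case 1
    then have "mat_trace (R g) = 0" if "g \<in> carrier G" for g
      using Rc[OF that] by (simp add: mat_trace_def)
    then show ?thesis by (intro exI[of _ "[]"]) simp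
  next
    case 2
    then have "rep_character G n R \<in> irr_chars G" by (auto simp: irr_chars_def)
    then show ?thesis
      using rep_character_eq_trace[OF group_axioms less.prems]
      by (intro exI[of _ "[rep_character G n R]"]) simp
  next
    case 3
    then obtain W where W: "VectorSpace.subspace class_ring W (module_vec TYPE(complex) n)"
      and inv: "\<And>g w. g \<in> carrier G \<Longrightarrow> w \<in> W \<Longrightarrow> R g *\<^sub>v w \<in> W"
      and "W \<noteq> {0\<^sub>v n}" "W \<noteq> carrier_vec n"
      using less.prems unfolding irreducible_rep_def by blast
    then obtain P Q k where P: "P \<in> carrier_mat n n" and Q: "Q \<in> carrier_mat n n"
      and PQ: "P * Q = 1\<^sub>m n" and QP: "Q * P = 1\<^sub>m n" and k: "0 < k" "k < n"
      and colP: "\<And>j. j < k \<Longrightarrow> col P j \<in> W"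
      and zero: "\<And>w i. w \<in> W \<Longrightarrow> k \<le> i \<Longrightarrow> i < n \<Longrightarrow> (Q *\<^sub>v w) $ i = 0"
      using adapted_basis_matrix by (metis (no_types, lifting))
    define S where "S g = Q * R g * P" for g
    have Sc: "S g \<in> carrier_mat n n" if "g \<in> carrier G" for g
      using Rc[OF that] P Q by (simp add: S_def)
    have S_mult: "S (g \<otimes> h) = S g * S h" if g: "g \<in> carrier G" and h: "h \<in> carrier G" for g h
    proof -
      have [simp]: "R g \<in> carrier_mat n n" "R h \<in> carrier_mat n n" using Rc g h by auto
      have "S g * S h = Q * (R g * (P * (Q * (R h * P))))"
        using P Q by (simp add: S_def assoc_mult_mat[of _ n n _ n _ n] mult_carrier_mat[of _ n n _ n])
      also have "P * (Q * (R h * P)) = P * Q * (R h * P)"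
        using P Q by (simp add: assoc_mult_mat[of _ n n _ n _ n] mult_carrier_mat[of _ n n _ n])
      also have "\<dots> = R h * P" using P PQ by (simp add: left_mult_one_mat[of _ n n] mult_carrier_mat[of _ n n _ n])
      also have "Q * (R g * (R h * P)) = Q * (R g * R h) * P"
        using P Q by (simp add: assoc_mult_mat[of _ n n _ n _ n] mult_carrier_mat[of _ n n _ n])
      also have "\<dots> = S (g \<otimes> h)" using R g h by (simp add: S_def)
      finally show ?thesis ..
    qed
    have S_one: "S \<one> = 1\<^sub>m n" using R QP Q by (simp add: S_def)
    have S_zero: "S g $$ (i, j) = 0" if g: "g \<in> carrier G" and i: "k \<le> i" "i < n" and j: "j < k" for g i j
    proof -
      have "S g $$ (i, j) = col (S g) j $ i" using Sc[OF g] i j k by simp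
      also have "col (S g) j = Q *\<^sub>v (R g *\<^sub>v col P j)"
      proof -
        have "j < n" using j k by simp
        then have "col (S g) j = Q * R g *\<^sub>v col P j"
          unfolding S_def by (rule col_mult2[OF mult_carrier_mat[OF Q Rc[OF g]] P])
        also have "\<dots> = Q *\<^sub>v (R g *\<^sub>v col P j)"
          by (rule assoc_mult_mat_vec[OF Q Rc[OF g]]) (use P in auto)
        finally show ?thesis .
      qed
      finally show ?thesis using zero[OF inv[OF g colP[OF j]] i] by simp
    qed
    have split: "sum f {..<n} = sum f {..<k} + (\<Sum>i<n-k. f (i + k))" for f :: "nat \<Rightarrow> complex"
    proof -
      have "sum f {..<n} = sum f {..<k} + sum f {k..<n}"
        using k by (simp add: atLeast0LessThan[symmetric] sum.atLeastLessThan_concat)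
      also have "sum f {k..<n} = (\<Sum>i<n-k. f (i + k))"
        using sum.shift_bounds_nat_ivl[of f 0 k "n - k"] k by (simp add: atLeast0LessThan)
      finally show ?thesis .
    qed
    have S_mult_entry: "S (g \<otimes> h) $$ (i, j) = (\<Sum>l<n. S g $$ (i, l) * S h $$ (l, j))"
      if "g \<in> carrier G" "h \<in> carrier G" "i < n" "j < n" for g h i j
      unfolding S_mult[OF that(1,2)] using Sc[OF that(1)] Sc[OF that(2)] that(3,4)
      by (simp add: scalar_prod_def atLeast0LessThan)
    define R1 where "R1 g = mat k k (\<lambda>(i, j). S g $$ (i, j))" for g
    define R2 where "R2 g = mat (n - k) (n - k) (\<lambda>(i, j). S g $$ (i + k, j + k))" for g
    have "R1 \<in> hom G (GL k)"
      unfolding hom_GL_iff[OF group_axioms]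
    proof (intro conjI ballI)
      fix g h assume g: "g \<in> carrier G" and h: "h \<in> carrier G"
      show "R1 (g \<otimes> h) = R1 g * R1 h"
        by (rule eq_matI)
          (use g h k in \<open>auto simp: R1_def S_mult_entry scalar_prod_def atLeast0LessThan split S_zero\<close>)
    qed (use S_one k in \<open>auto simp: R1_def intro!: eq_matI\<close>)
    moreover have "R2 \<in> hom G (GL (n - k))"
      unfolding hom_GL_iff[OF group_axioms]
    proof (intro conjI ballI)
      fix g h assume g: "g \<in> carrier G" and h: "h \<in> carrier G"
      show "R2 (g \<otimes> h) = R2 g * R2 h"
        by (rule eq_matI)
          (use g h k in \<open>auto simp: R2_def S_mult_entry scalar_prod_def atLeast0LessThan split S_zero\<close>)
    qed (use S_one k in \<open>auto simp: R2_def intro!: eq_matI\<close>)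
    ultimately obtain cs1 cs2 where cs: "set cs1 \<subseteq> irr_chars G" "set cs2 \<subseteq> irr_chars G"
      "\<And>g. g \<in> carrier G \<Longrightarrow> mat_trace (R1 g) = (\<Sum>\<chi>\<leftarrow>cs1. \<chi> g)"
      "\<And>g. g \<in> carrier G \<Longrightarrow> mat_trace (R2 g) = (\<Sum>\<chi>\<leftarrow>cs2. \<chi> g)"
      using less.IH[of k R1] less.IH[of "n - k" R2] k by auto
    have "mat_trace (R g) = mat_trace (R1 g) + mat_trace (R2 g)" if g: "g \<in> carrier G" for g
    proof -
      have "mat_trace (R g) = mat_trace (S g)"
        unfolding S_def using mat_trace_conjugate[OF Rc[OF g] Q P PQ] by simp
      also have "\<dots> = mat_trace (R1 g) + mat_trace (R2 g)"
        using Sc[OF g] by (simp add: mat_trace_def R1_def R2_def split)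
      finally show ?thesis .
    qed
    then show ?thesis using cs by (intro exI[of _ "cs1 @ cs2"]) simp
  qed
qed

text \<open>The permutation matrices of left multiplication, for an enumeration \<open>e\<close> of the group. Only the
identity fixes a point, which gives the trace.\<close>

lemma (in group) regular_representation:
  assumes fin: "finite (carrier G)"
  obtains R n where "R \<in> hom G (GL n)"
    "\<And>g. g \<in> carrier G \<Longrightarrow> mat_trace (R g) = (if g = \<one> then of_nat (card (carrier G)) else 0)"
proof -
  define n where "n = card (carrier G)"
  obtain e where e: "bij_betw e {..<n} (carrier G)"
    using ex_bij_betw_nat_finite[OF fin] by (auto simp: n_def atLeast0LessThan)
  have ec: "e i \<in> carrier G" if "i < n" for i using e that by (auto simp: bij_betw_def)
  have e_inj: "e i = e j \<longleftrightarrow> i = j" if "i < n" "j < n" for i j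
    using e that by (auto simp: bij_betw_def inj_on_def)
  define R where "R g = mat n n (\<lambda>(i, j). if e i = g \<otimes> e j then 1 else (0::complex))" for g
  have "R \<in> hom G (GL n)"
    unfolding hom_GL_iff[OF group_axioms]
  proof (intro conjI ballI)
    fix g h assume g: "g \<in> carrier G" and h: "h \<in> carrier G"
    show "R (g \<otimes> h) = R g * R h"
    proof (rule eq_matI)
      fix i j assume "i < dim_row (R g * R h)" "j < dim_col (R g * R h)"
      then have ij: "i < n" "j < n" by (auto simp: R_def)
      have "h \<otimes> e j \<in> e ` {..<n}" using e h ec[OF ij(2)] by (simp add: bij_betw_def)
      then obtain l where l: "l < n" "e l = h \<otimes> e j" by auto
      have "(R g * R h) $$ (i, j) =
          (\<Sum>m<n. (if e i = g \<otimes> e m then 1 else 0) * (if e m = h \<otimes> e j then 1 else 0))"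
        using ij by (simp add: R_def scalar_prod_def atLeast0LessThan)
      also have "\<dots> = (\<Sum>m<n. if m = l then (if e i = g \<otimes> (h \<otimes> e j) then 1 else 0) else 0)"
        by (intro sum.cong refl) (simp add: l(2)[symmetric] e_inj l(1))
      also have "\<dots> = (if e i = g \<otimes> (h \<otimes> e j) then 1 else 0)" using l by simp
      also have "\<dots> = R (g \<otimes> h) $$ (i, j)" using ij g h ec by (simp add: R_def m_assoc)
      finally show "R (g \<otimes> h) $$ (i, j) = (R g * R h) $$ (i, j)" ..
    qed (simp_all add: R_def)
  qed (auto simp: R_def e_inj ec intro!: eq_matI)
  moreover have "mat_trace (R g) = (if g = \<one> then of_nat (card (carrier G)) else 0)" if g: "g \<in> carrier G" for g
  proof -
    have "e i = g \<otimes> e i \<longleftrightarrow> g = \<one>" if "i < n" for i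
      using ec[OF that] g by (metis l_one one_closed right_cancel)
    then show ?thesis by (simp add: mat_trace_def R_def n_def)
  qed
  ultimately show thesis by (rule that)
qed

lemma (in group) irr_char_degree:
  assumes "\<chi> \<in> irr_chars G"
  shows "\<exists>n. n > 0 \<and> \<chi> \<one> = of_nat n"
proof -
  obtain n \<rho> where \<rho>: "irreducible_rep G n \<rho>" "\<chi> = rep_character G n \<rho>"
    using assms by (auto simp: irr_chars_def)
  then show ?thesis
    using irreducible_repD(2,5)[OF group_axioms \<rho>(1)]
    by (intro exI[of _ n]) (simp add: rep_character_def)
qed

lemma (in group) irr_char_degree_nonzero: "\<chi> \<in> irr_chars G \<Longrightarrow> \<chi> \<one> \<noteq> 0"
  using irr_char_degree by fastforce

lemma sum_list_map_eq_sum_count_list: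
  fixes f :: "'b \<Rightarrow> 'a::comm_semiring_1"
  shows "(\<Sum>x\<leftarrow>xs. f x) = (\<Sum>x\<in>set xs. of_nat (count_list xs x) * f x)"
proof -
  have "(\<Sum>x\<leftarrow>xs. f x) = (\<Sum>x\<in>S. of_nat (count_list xs x) * f x)" if "finite S" "set xs \<subseteq> S" for S
    using that(2)
  proof (induction xs)
    case (Cons a xs)
    have "(\<Sum>x\<in>S. of_nat (count_list (a # xs) x) * f x) =
      (\<Sum>x\<in>S. (if x = a then f a else 0) + of_nat (count_list xs x) * f x)"
      by (intro sum.cong refl) (auto simp: algebra_simps)
    then show ?case using Cons that(1) by (simp add: sum.distrib)
  qed simp
  then show ?thesis by simp
qed

text \<open>The regular character is a sum of irreducible characters, and pairing it with \<open>\<chi>\<close> shows that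
\<open>\<chi>\<close> occurs \<open>\<chi>(1)\<close> times. As this is never zero, every irreducible character occurs in one finite
list, so there are only finitely many.\<close>

theorem (in group) irr_chars_regular_sum:
  assumes fin: "finite (carrier G)"
  shows finite_irr_chars: "finite (irr_chars G)"
    and irr_chars_column_sum: "g \<in> carrier G \<Longrightarrow>
      (\<Sum>\<chi>\<in>irr_chars G. \<chi> \<one> * \<chi> g) = (if g = \<one> then of_nat (card (carrier G)) else 0)"
proof -
  define N :: complex where "N = of_nat (card (carrier G))"
  have N0: "N \<noteq> 0" using fin by (auto simp: N_def)
  obtain R n where R: "R \<in> hom G (GL n)"
    and tr: "\<And>g. g \<in> carrier G \<Longrightarrow> mat_trace (R g) = (if g = \<one> then N else 0)"
    using regular_representation[OF fin] unfolding N_def by blast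
  obtain cs where cs: "set cs \<subseteq> irr_chars G"
    and sum: "\<And>g. g \<in> carrier G \<Longrightarrow> mat_trace (R g) = (\<Sum>\<chi>\<leftarrow>cs. \<chi> g)"
    using character_sum_of_irr_chars[OF R] by auto
  have reg: "(\<Sum>\<psi>\<in>set cs. of_nat (count_list cs \<psi>) * \<psi> g) = (if g = \<one> then N else 0)"
    if "g \<in> carrier G" for g
    using tr[OF that] sum[OF that] by (simp add: sum_list_map_eq_sum_count_list)
  have mult: "\<chi> \<one> = of_nat (count_list cs \<chi>)" if \<chi>: "\<chi> \<in> irr_chars G" for \<chi>
  proof -
    have "N * \<chi> \<one> = (\<Sum>g\<in>carrier G. if g = \<one> then N * \<chi> \<one> else 0)"
      using fin by simp
    also have "\<dots> = (\<Sum>g\<in>carrier G. (\<Sum>\<psi>\<in>set cs. of_nat (count_list cs \<psi>) * \<psi> g) * \<chi> (inv g))"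
      by (intro sum.cong refl) (simp add: reg)
    also have "\<dots> = (\<Sum>\<psi>\<in>set cs. of_nat (count_list cs \<psi>) * (\<Sum>g\<in>carrier G. \<psi> g * \<chi> (inv g)))"
      by (subst sum_distrib_left, subst sum.swap)
        (simp add: sum_distrib_right sum_distrib_left mult.assoc)
    also have "\<dots> = (\<Sum>\<psi>\<in>set cs. if \<psi> = \<chi> then of_nat (count_list cs \<chi>) * N else 0)"
      by (intro sum.cong refl) (use cs irr_chars_orthogonality[OF _ \<chi>] in \<open>auto simp: N_def\<close>)
    also have "\<dots> = of_nat (count_list cs \<chi>) * N"
      by (simp add: count_list_0_iff)
    finally show ?thesis using N0 by simp
  qed
  have eq: "irr_chars G = set cs"
  proof
    show "irr_chars G \<subseteq> set cs"
    proof
      fix \<chi> assume "\<chi> \<in> irr_chars G"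
      then have "count_list cs \<chi> \<noteq> 0" using mult irr_char_degree by fastforce
      then show "\<chi> \<in> set cs" by (simp add: count_list_0_iff)
    qed
  qed (rule cs)
  show "finite (irr_chars G)" by (simp add: eq)
  show "(\<Sum>\<chi>\<in>irr_chars G. \<chi> \<one> * \<chi> g) = (if g = \<one> then of_nat (card (carrier G)) else 0)"
    if "g \<in> carrier G"
    using reg[OF that] mult by (simp add: eq[symmetric] N_def)
qed

section \<open>Matrices of finite order\<close>

text \<open>Induction on the columns. If \<open>B\<close> fixes the first \<open>j\<close> unit vectors, then it maps \<open>e\<^sub>j\<close> to \<open>e\<^sub>j + u\<close>
with \<open>u\<close> a combination of these vectors, so \<open>B u = u\<close> and \<open>B\<^sup>k e\<^sub>j = e\<^sub>j + k u\<close>. Finite order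
forces \<open>u = 0\<close> in characteristic zero.\<close>

lemma unitriangular_finite_order_eq_one:
  fixes B :: "complex mat"
  assumes B: "B \<in> carrier_mat n n" and ut: "upper_triangular B"
    and diag: "\<And>i. i < n \<Longrightarrow> B $$ (i, i) = 1"
    and pow: "B ^\<^sub>m m = 1\<^sub>m n" and m: "m > 0"
  shows "B = 1\<^sub>m n"
proof -
  have "col B j = unit_vec n j" if "j < n" for j
    using that
  proof (induction j rule: less_induct)
    case (less j)
    define u where "u = B *\<^sub>v unit_vec n j - unit_vec n j"
    have u: "u \<in> carrier_vec n" using B by (auto simp: u_def)
    have Be: "B *\<^sub>v unit_vec n j = unit_vec n j + u"
      using B by (intro eq_vecI) (auto simp: u_def)
    have u_zero: "u $ i = 0" if "i < n" "j \<le> i" for i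
      using that less.prems B ut diag[of j] by (cases "i = j") (auto simp: u_def upper_triangularD)
    have Bu: "B *\<^sub>v u = u"
    proof (rule eq_vecI)
      fix l assume "l < dim_vec u"
      then have l: "l < n" using u by simp
      have "B $$ (l, i) * u $ i = (if i = l then u $ l else 0)" if i: "i < n" for i
      proof (cases "i < j")
        case True
        have "B $$ (l, i) = col B i $ l" using B l i by simp
        then show ?thesis using less.IH[OF True i] l i by simp
      next
        case False
        then show ?thesis using u_zero[OF i] by auto
      qed
      then have "(\<Sum>i<n. B $$ (l, i) * u $ i) = (\<Sum>i<n. if i = l then u $ l else 0)"
        by (intro sum.cong) auto
      then show "(B *\<^sub>v u) $ l = u $ l"
        using l u B by (simp add: scalar_prod_def atLeast0LessThan)
    qed (use u B in auto)
    have Pu: "B ^\<^sub>m k *\<^sub>v u = u" for k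
    proof (induction k)
      case (Suc k)
      have "B ^\<^sub>m Suc k *\<^sub>v u = B ^\<^sub>m k *\<^sub>v (B *\<^sub>v u)"
        using B u by (simp add: assoc_mult_mat_vec[OF pow_carrier_mat[OF B] B u])
      then show ?case using Bu Suc by simp
    qed (use u B in auto)
    have Pe: "B ^\<^sub>m k *\<^sub>v unit_vec n j = unit_vec n j + of_nat k \<cdot>\<^sub>v u" for k
    proof (induction k)
      case 0
      then show ?case using u B by auto
    next
      case (Suc k)
      have "B ^\<^sub>m Suc k *\<^sub>v unit_vec n j = B ^\<^sub>m k *\<^sub>v (B *\<^sub>v unit_vec n j)"
        by (simp add: assoc_mult_mat_vec[OF pow_carrier_mat[OF B] B])
      also have "\<dots> = B ^\<^sub>m k *\<^sub>v unit_vec n j + B ^\<^sub>m k *\<^sub>v u"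
        unfolding Be by (rule mult_add_distrib_mat_vec[OF pow_carrier_mat[OF B] _ u]) simp
      also have "\<dots> = unit_vec n j + of_nat (Suc k) \<cdot>\<^sub>v u"
        unfolding Suc Pu using u by (intro eq_vecI) (auto simp: algebra_simps)
      finally show ?case .
    qed
    have "unit_vec n j = unit_vec n j + of_nat m \<cdot>\<^sub>v u"
      using Pe[of m] by (simp add: pow)
    then have "unit_vec n j $ i = (unit_vec n j + of_nat m \<cdot>\<^sub>v u) $ i" for i by simp
    then have "u $ i = 0" if "i < n" for i
      using that u m less.prems by (metis add_cancel_right_right carrier_vecD index_add_vec(1)
          index_smult_vec(1) index_smult_vec(2) mult_eq_0_iff neq0_conv of_nat_eq_0_iff)
    then have "B *\<^sub>v unit_vec n j = unit_vec n j"
      unfolding Be using u by (intro eq_vecI) auto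
    moreover have "B *\<^sub>v unit_vec n j = col B j"
      using B less.prems by (intro eq_vecI) auto
    ultimately show ?case by simp
  qed
  then show ?thesis using B by (intro mat_col_eqI) auto
qed

lemma sum_unimodular_eq_card_imp_one:
  fixes z :: "'i \<Rightarrow> complex"
  assumes "finite I" "\<And>i. i \<in> I \<Longrightarrow> norm (z i) = 1" "(\<Sum>i\<in>I. z i) = of_nat (card I)" "i \<in> I"
  shows "z i = 1"
proof -
  have "(\<Sum>i\<in>I. 1 - Re (z i)) = 0"
    using arg_cong[OF assms(3), of Re] by (simp add: sum_subtractf)
  moreover have nonneg: "0 \<le> 1 - Re (z i)" if "i \<in> I" for i
    using complex_Re_le_cmod[of "z i"] assms(2)[OF that] by simp
  ultimately have Re: "Re (z i) = 1"
    using sum_nonneg_eq_0_iff[OF assms(1), of "\<lambda>i. 1 - Re (z i)"] assms(4) by simp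
  then have "Im (z i) = 0" using assms(2)[OF assms(4)] cmod_power2[of "z i"] by simp
  then show ?thesis using Re by (simp add: complex_eq_iff)
qed

text \<open>After triangularisation the diagonal consists of \<open>n\<close> roots of unity with sum \<open>n\<close>, so all of them
are one.\<close>

lemma finite_order_trace_eq_dim_imp_one:
  fixes A :: "complex mat"
  assumes A: "A \<in> carrier_mat n n" and pow: "A ^\<^sub>m m = 1\<^sub>m n" and m: "m > 0"
    and tr: "mat_trace A = of_nat n"
  shows "A = 1\<^sub>m n"
proof -
  obtain es where es: "char_poly A = (\<Prod>e\<leftarrow>es. [:- e, 1:])"
    using char_poly_factorized[OF A] by blast
  obtain B P Q where sd: "schur_decomposition A es = (B, P, Q)"
    by (cases "schur_decomposition A es")
  have sim: "similar_mat_wit A B P Q" and ut: "upper_triangular B" and diag: "diag_mat B = es"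
    using schur_decomposition[OF A es sd] by auto
  have PQ: "P * Q = 1\<^sub>m n" "Q * P = 1\<^sub>m n" and A_eq: "A = P * B * Q"
    and B: "B \<in> carrier_mat n n" and P: "P \<in> carrier_mat n n" and Q: "Q \<in> carrier_mat n n"
    using similar_mat_witD2[OF A sim] by auto
  have "B ^\<^sub>m m = 1\<^sub>m n"
  proof -
    have "similar_mat_wit (B ^\<^sub>m m) (A ^\<^sub>m m) Q P"
      by (rule similar_mat_wit_pow[OF similar_mat_wit_sym[OF sim]])
    then have "B ^\<^sub>m m = Q * 1\<^sub>m n * P"
      using similar_mat_witD2[OF pow_carrier_mat[OF B]] pow by metis
    then show ?thesis using PQ Q by simp
  qed
  moreover have "B $$ (i, i) = 1" if i: "i < n" for i
  proof (rule sum_unimodular_eq_card_imp_one[of "{..<n}" "\<lambda>i. B $$ (i, i)"])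
    fix i assume "i \<in> {..<n}"
    then have "B $$ (i, i) \<in> set es" using B by (auto simp: diag[symmetric] diag_mat_def)
    then have "poly (char_poly A) (B $$ (i, i)) = 0"
      unfolding es by (auto simp: poly_prod_list prod_list_zero_iff)
    then obtain v where v: "eigenvector A v (B $$ (i, i))"
      using eigenvalue_root_char_poly[OF A] by (auto simp: eigenvalue_def)
    then have vc: "v \<in> carrier_vec n" "v \<noteq> 0\<^sub>v n" using A by (auto simp: eigenvector_def)
    have "v = (B $$ (i, i)) ^ m \<cdot>\<^sub>v v"
      using eigenvector_pow[OF A v, of m] vc by (simp add: pow)
    moreover obtain l where "l < n" "v $ l \<noteq> 0"
      using vc by (metis eq_vecI carrier_vecD index_zero_vec(1) index_zero_vec(2))
    ultimately have "(B $$ (i, i)) ^ m = 1"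
      using vc(1) by (metis carrier_vecD index_smult_vec(1) mult_cancel_right1)
    then show "norm (B $$ (i, i)) = 1"
      using m power_eq_1_iff by blast
  next
    have "mat_trace A = mat_trace B"
      unfolding A_eq by (rule mat_trace_conjugate[OF B P Q PQ(2)])
    then show "(\<Sum>i<n. B $$ (i, i)) = of_nat (card {..<n})"
      using tr B by (simp add: mat_trace_def)
  qed (use i in auto)
  ultimately have "B = 1\<^sub>m n"
    using unitriangular_finite_order_eq_one[OF B ut _ _ m] by blast
  then show ?thesis using A_eq P PQ by simp
qed

section \<open>Kernels of irreducible characters\<close>

definition char_kernel :: "('a, 'm) monoid_scheme \<Rightarrow> ('a \<Rightarrow> complex) \<Rightarrow> 'a set" where
  "char_kernel G \<chi> = {g \<in> carrier G. \<chi> g = \<chi> \<one>\<^bsub>G\<^esub>}"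

text \<open>An element of a finite group acts by a matrix of finite order, so the trace criterion for the
identity matrix applies.\<close>

lemma (in group) rep_eq_one_iff_character:
  assumes fin: "finite (carrier G)" and \<rho>: "irreducible_rep G n \<rho>" and g: "g \<in> carrier G"
  shows "\<rho> g = 1\<^sub>m n \<longleftrightarrow> rep_character G n \<rho> g = rep_character G n \<rho> \<one>"
proof
  note r = irreducible_repD[OF group_axioms \<rho>]
  have deg: "rep_character G n \<rho> \<one> = of_nat n" using r by (simp add: rep_character_def)
  have pow: "\<rho> (g [^] k) = \<rho> g ^\<^sub>m k" for k :: nat
  proof (induction k)
    case 0
    then show ?case using r(5) carrier_matD(1)[OF r(3)[OF g]] by simp
  next
    case (Suc k)
    then show ?case using g r(4)[of "g [^] k" g] by simp
  qed
  show "\<rho> g = 1\<^sub>m n" if "rep_character G n \<rho> g = rep_character G n \<rho> \<one>"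
  proof (rule finite_order_trace_eq_dim_imp_one[OF r(3)[OF g]])
    show "\<rho> g ^\<^sub>m Coset.order G = 1\<^sub>m n"
      using pow[of "Coset.order G"] g r(5) by (simp add: pow_order_eq_1)
    show "Coset.order G > 0" using fin by (simp add: order_gt_0_iff_finite)
    show "mat_trace (\<rho> g) = of_nat n"
      using that deg rep_character_eq_trace[OF group_axioms r(1) g] by simp
  qed
qed (use irreducible_repD(5)[OF group_axioms \<rho>] g in \<open>simp add: rep_character_def\<close>)

lemma (in group) char_kernel_normal:
  assumes fin: "finite (carrier G)" and "\<chi> \<in> irr_chars G"
  shows "char_kernel G \<chi> \<lhd> G"
proof -
  obtain n \<rho> where \<rho>: "irreducible_rep G n \<rho>" "\<chi> = rep_character G n \<rho>"
    using assms(2) by (auto simp: irr_chars_def)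
  interpret R: ring "ring_mat TYPE(complex) n ()" by (rule ring_mat)
  have "group (GL n)" unfolding GL_def by (rule R.units_group)
  then interpret h: group_hom G "GL n" \<rho>
    by (intro group_hom.intro group_hom_axioms.intro)
      (auto simp: irreducible_repD(1)[OF group_axioms \<rho>(1)] group_axioms)
  have "char_kernel G \<chi> = kernel G (GL n) \<rho>"
    using rep_eq_one_iff_character[OF fin \<rho>(1)]
    by (auto simp: char_kernel_def \<rho>(2) kernel_def GL_def units_of_def ring_mat_simps)
  then show ?thesis using h.normal_kernel by simp
qed

text \<open>The vectors fixed by \<open>N\<close> form a subspace that is invariant under \<open>G\<close> because \<open>N\<close> is normal, so by
irreducibility it is everything or zero. The sum over \<open>N\<close> maps every vector to a fixed vector, so
in the second case it vanishes.\<close>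

lemma (in group) irreducible_normal_sum:
  assumes \<rho>: "irreducible_rep G n \<rho>" and N: "N \<lhd> G"
  shows "(\<forall>g\<in>N. \<rho> g = 1\<^sub>m n) \<or> mat_sum n n \<rho> N = 0\<^sub>m n n"
proof -
  interpret normal N G by fact
  note r = irreducible_repD[OF group_axioms \<rho>]
  define W where "W = {v \<in> carrier_vec n. \<forall>g\<in>N. \<rho> g *\<^sub>v v = v}"
  have "W = {0\<^sub>v n} \<or> W = carrier_vec n"
  proof (rule irreducible_rep_invariant_subspace[OF group_axioms \<rho>])
    show "0\<^sub>v n \<in> W" using mult_mat_vec_zero[OF r(3)] by (simp add: W_def)
    show "v + w \<in> W" if "v \<in> W" "w \<in> W" for v w
      using that mult_add_distrib_mat_vec[OF r(3)] by (simp add: W_def)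
    show "c \<cdot>\<^sub>v v \<in> W" if "v \<in> W" for c v
      using that mult_mat_vec[OF r(3)] by (simp add: W_def)
    show "\<rho> h *\<^sub>v w \<in> W" if h: "h \<in> carrier G" and w: "w \<in> W" for h w
    proof -
      have wc: "w \<in> carrier_vec n" using w by (simp add: W_def)
      have "\<rho> g *\<^sub>v (\<rho> h *\<^sub>v w) = \<rho> h *\<^sub>v w" if g: "g \<in> N" for g
      proof -
        have gc: "g \<in> carrier G" using g by simp
        define g' where "g' = inv h \<otimes> g \<otimes> h"
        have g': "g' \<in> N" unfolding g'_def using inv_op_closed1[OF h g] .
        then have g'c: "g' \<in> carrier G" by simp
        have "g \<otimes> h = h \<otimes> g'" using gc h by (simp add: g'_def m_assoc[symmetric])
        then have "\<rho> g * \<rho> h = \<rho> h * \<rho> g'"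
          using r(4)[OF gc h] r(4)[OF h g'c] by simp
        then have "\<rho> g *\<^sub>v (\<rho> h *\<^sub>v w) = \<rho> h *\<^sub>v (\<rho> g' *\<^sub>v w)"
          using assoc_mult_mat_vec[OF r(3)[OF gc] r(3)[OF h] wc]
            assoc_mult_mat_vec[OF r(3)[OF h] r(3)[OF g'c] wc] by simp
        then show ?thesis using w g' by (simp add: W_def)
      qed
      then show ?thesis using mult_mat_vec_carrier[OF r(3)[OF h] wc] by (simp add: W_def)
    qed
  qed (auto simp: W_def)
  then show ?thesis
  proof
    assume W: "W = carrier_vec n"
    have "\<rho> g = 1\<^sub>m n" if "g \<in> N" for g
      by (rule mat_eqI_mult_vec[OF r(3)]) (use that W in \<open>auto simp: W_def\<close>)
    then show ?thesis by simp
  next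
    assume W: "W = {0\<^sub>v n}"
    define F where "F = mat_sum n n \<rho> N"
    have F: "F \<in> carrier_mat n n" by (simp add: F_def)
    have gF: "\<rho> g * F = F" if g: "g \<in> N" for g
    proof -
      have gc: "g \<in> carrier G" using g by simp
      have "\<rho> g * F = mat_sum n n (\<lambda>x. \<rho> g * \<rho> x) N"
        unfolding F_def by (rule mult_mat_sum[OF r(3)[OF gc]]) (simp add: r(3))
      also have "\<dots> = F"
        unfolding F_def
      proof (rule mat_sum_reindex)
        show "bij_betw (\<lambda>x. g \<otimes> x) N N"
          by (rule bij_betw_byWitness[where f' = "\<lambda>x. inv g \<otimes> x"])
            (use g in \<open>auto simp: m_assoc[symmetric]\<close>)
      qed (use gc r(4) in simp)
      finally show ?thesis .
    qed
    have "F *\<^sub>v v = 0\<^sub>v n" if v: "v \<in> carrier_vec n" for v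
    proof -
      have "\<rho> g *\<^sub>v (F *\<^sub>v v) = F *\<^sub>v v" if g: "g \<in> N" for g
        using assoc_mult_mat_vec[OF r(3) F v] gF[OF g] g by (metis mem_carrier)
      then have "F *\<^sub>v v \<in> W" using mult_mat_vec_carrier[OF F v] by (simp add: W_def)
      then show ?thesis using W by simp
    qed
    then have "F = 0\<^sub>m n n" by (intro mat_eqI_mult_vec[OF F]) auto
    then show ?thesis by (simp add: F_def)
  qed
qed

lemma (in group) irr_char_normal_coset_sum:
  assumes fin: "finite (carrier G)" and \<chi>: "\<chi> \<in> irr_chars G" and N: "N \<lhd> G" and x: "x \<in> carrier G"
  shows "(\<Sum>g\<in>N. \<chi> (x \<otimes> g)) = (if N \<subseteq> char_kernel G \<chi> then of_nat (card N) * \<chi> x else 0)"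
proof -
  interpret normal N G by fact
  obtain n \<rho> where \<rho>: "irreducible_rep G n \<rho>" "\<chi> = rep_character G n \<rho>"
    using \<chi> by (auto simp: irr_chars_def)
  note r = irreducible_repD[OF group_axioms \<rho>(1)]
  note tr = rep_character_eq_trace[OF group_axioms r(1)]
  have triv: "N \<subseteq> char_kernel G \<chi> \<longleftrightarrow> (\<forall>g\<in>N. \<rho> g = 1\<^sub>m n)"
    using rep_eq_one_iff_character[OF fin \<rho>(1)] by (auto simp: char_kernel_def \<rho>(2))
  have *: "\<chi> (x \<otimes> g) = mat_trace (\<rho> x * \<rho> g)" if "g \<in> N" for g
    using that x by (simp add: \<rho>(2) tr r(4))
  show ?thesis
  proof (cases "\<forall>g\<in>N. \<rho> g = 1\<^sub>m n")
    case True
    have "\<chi> (x \<otimes> g) = \<chi> x" if "g \<in> N" for g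
      using *[OF that] True that x r(3)[OF x] by (simp add: \<rho>(2) tr)
    then show ?thesis using True triv by simp
  next
    case False
    then have zero: "mat_sum n n \<rho> N = 0\<^sub>m n n"
      using irreducible_normal_sum[OF \<rho>(1) N] by blast
    have "(\<Sum>g\<in>N. \<chi> (x \<otimes> g)) = mat_trace (mat_sum n n (\<lambda>g. \<rho> x * \<rho> g) N)"
      using x r(3) by (subst mat_sum_trace) (auto simp: * intro!: mult_carrier_mat[of _ n n])
    also have "mat_sum n n (\<lambda>g. \<rho> x * \<rho> g) N = \<rho> x * mat_sum n n \<rho> N"
      by (rule mult_mat_sum[symmetric]) (use x r(3) in auto)
    also have "mat_trace \<dots> = 0" using r(3)[OF x] by (simp add: zero mat_trace_def)
    finally have "(\<Sum>g\<in>N. \<chi> (x \<otimes> g)) = 0" .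
    moreover have "\<not> N \<subseteq> char_kernel G \<chi>" using False triv by blast
    ultimately show ?thesis by simp
  qed
qed

text \<open>Summing the regular character over the coset \<open>xN\<close> gives the right-hand side. On the other hand each
irreducible summand survives, multiplied by \<open>|N|\<close>, exactly if \<open>N\<close> lies in its kernel. So the
characters with kernel above \<open>N\<close> detect membership in \<open>N\<close>, and at \<open>x = 1\<close> their squared degrees add
up to the index of \<open>N\<close>.\<close>

theorem (in group) irr_chars_normal_column_sum:
  assumes fin: "finite (carrier G)" and N: "N \<lhd> G" and x: "x \<in> carrier G"
  shows "of_nat (card N) * (\<Sum>\<chi> | \<chi> \<in> irr_chars G \<and> N \<subseteq> char_kernel G \<chi>. \<chi> \<one> * \<chi> x) =
    (if x \<in> N then of_nat (card (carrier G)) else 0)"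
proof -
  interpret normal N G by fact
  have finI: "finite (irr_chars G)" by (rule finite_irr_chars[OF fin])
  have finN: "finite N" using fin subset finite_subset by blast
  have "of_nat (card N) * (\<Sum>\<chi> | \<chi> \<in> irr_chars G \<and> N \<subseteq> char_kernel G \<chi>. \<chi> \<one> * \<chi> x) =
    (\<Sum>\<chi>\<in>irr_chars G. \<chi> \<one> * (if N \<subseteq> char_kernel G \<chi> then of_nat (card N) * \<chi> x else 0))"
    unfolding sum_distrib_left
    by (rule sum.mono_neutral_cong_left) (use finI in auto)
  also have "\<dots> = (\<Sum>\<chi>\<in>irr_chars G. \<chi> \<one> * (\<Sum>g\<in>N. \<chi> (x \<otimes> g)))"
    by (intro sum.cong refl) (simp add: irr_char_normal_coset_sum[OF fin _ N x])
  also have "\<dots> = (\<Sum>g\<in>N. \<Sum>\<chi>\<in>irr_chars G. \<chi> \<one> * \<chi> (x \<otimes> g))"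
    by (subst sum.swap) (simp add: sum_distrib_left)
  also have "\<dots> = (\<Sum>g\<in>N. if g = inv x then of_nat (card (carrier G)) else 0)"
  proof (intro sum.cong refl)
    fix g assume "g \<in> N"
    then have g: "g \<in> carrier G" by simp
    have "x \<otimes> g = \<one> \<longleftrightarrow> g = inv x"
      using g x by (metis inv_comm inv_equality inv_inv r_inv)
    then show "(\<Sum>\<chi>\<in>irr_chars G. \<chi> \<one> * \<chi> (x \<otimes> g)) = (if g = inv x then of_nat (card (carrier G)) else 0)"
      using irr_chars_column_sum[OF fin, of "x \<otimes> g"] g x by simp
  qed
  also have "\<dots> = (if inv x \<in> N then of_nat (card (carrier G)) else 0)"
    using finN by simp
  also have "inv x \<in> N \<longleftrightarrow> x \<in> N" using x m_inv_closed by (metis inv_inv)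
  finally show ?thesis .
qed

text \<open>For such an \<open>x\<close> the column sum has the same value at \<open>x\<close> as at \<open>1 \<in> N\<close>, where it is not zero.\<close>

corollary (in group) mem_normal_if_mem_char_kernels:
  assumes fin: "finite (carrier G)" and N: "N \<lhd> G" and x: "x \<in> carrier G"
    and ker: "\<And>\<chi>. \<chi> \<in> irr_chars G \<Longrightarrow> N \<subseteq> char_kernel G \<chi> \<Longrightarrow> x \<in> char_kernel G \<chi>"
  shows "x \<in> N"
proof -
  have "(\<Sum>\<chi> | \<chi> \<in> irr_chars G \<and> N \<subseteq> char_kernel G \<chi>. \<chi> \<one> * \<chi> x) =
    (\<Sum>\<chi> | \<chi> \<in> irr_chars G \<and> N \<subseteq> char_kernel G \<chi>. \<chi> \<one> * \<chi> \<one>)"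
    by (intro sum.cong refl) (use ker in \<open>auto simp: char_kernel_def\<close>)
  moreover have "\<one> \<in> N" using N by (simp add: normal_imp_subgroup subgroup.one_closed)
  moreover have "card (carrier G) \<noteq> 0" using fin by auto
  ultimately show ?thesis
    using irr_chars_normal_column_sum[OF fin N x] irr_chars_normal_column_sum[OF fin N one_closed]
    by (simp split: if_splits)
qed

lemma (in group) inter_char_kernels_normal:
  assumes fin: "finite (carrier G)" and "A \<subseteq> irr_chars G"
  shows "{g \<in> carrier G. \<forall>\<chi>\<in>A. g \<in> char_kernel G \<chi>} \<lhd> G"
proof -
  have n: "char_kernel G \<chi> \<lhd> G" if "\<chi> \<in> A" for \<chi>
    using that assms char_kernel_normal by blast
  note s = normal_imp_subgroup[OF n]
  show ?thesis
  proof (rule normal_invI)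
    show "subgroup {g \<in> carrier G. \<forall>\<chi>\<in>A. g \<in> char_kernel G \<chi>} G"
      by (rule subgroupI)
        (use s[THEN subgroup.one_closed] s[THEN subgroup.m_inv_closed] s[THEN subgroup.m_closed] in auto)
    show "x \<otimes> h \<otimes> inv x \<in> {g \<in> carrier G. \<forall>\<chi>\<in>A. g \<in> char_kernel G \<chi>}"
      if "x \<in> carrier G" "h \<in> {g \<in> carrier G. \<forall>\<chi>\<in>A. g \<in> char_kernel G \<chi>}" for x h
      using that normal.inv_op_closed2[OF n] by auto
  qed
qed

section \<open>Duality of normal subgroups\<close>

lemma (in group) normal_set_mult_normal:
  assumes M: "M \<lhd> G" and N: "N \<lhd> G"
  shows "M <#> N \<lhd> G"
proof (rule normal_invI)
  show "subgroup (M <#> N) G"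
    by (rule mult_norm_subgroup[OF M]) (use N in \<open>simp add: normal_imp_subgroup\<close>)
  fix x h assume x: "x \<in> carrier G" and "h \<in> M <#> N"
  then obtain a b where ab: "a \<in> M" "b \<in> N" "h = a \<otimes> b" by (auto simp: set_mult_def)
  have abc: "a \<in> carrier G" "b \<in> carrier G"
    using ab M N by (meson normal_imp_subgroup subgroup.mem_carrier)+
  have "x \<otimes> h \<otimes> inv x = (x \<otimes> a \<otimes> inv x) \<otimes> (x \<otimes> b \<otimes> inv x)"
    using x abc ab(3) by (simp add: m_assoc inv_solve_left)
  moreover have "x \<otimes> a \<otimes> inv x \<in> M" "x \<otimes> b \<otimes> inv x \<in> N"
    using M N x ab by (simp_all add: normal.inv_op_closed2)
  ultimately show "x \<otimes> h \<otimes> inv x \<in> M <#> N" by (auto simp: set_mult_def)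
qed

lemma (in group) set_mult_subset_iff:
  assumes "subgroup M G" "subgroup N G" "subgroup K G"
  shows "M <#> N \<subseteq> K \<longleftrightarrow> M \<subseteq> K \<and> N \<subseteq> K"
proof
  assume *: "M <#> N \<subseteq> K"
  have "m \<otimes> \<one> \<in> M <#> N" if "m \<in> M" for m
    using that subgroup.one_closed[OF assms(2)] by (auto simp: set_mult_def)
  moreover have "\<one> \<otimes> n \<in> M <#> N" if "n \<in> N" for n
    using that subgroup.one_closed[OF assms(1)] by (auto simp: set_mult_def)
  ultimately show "M \<subseteq> K \<and> N \<subseteq> K"
    using * assms(1,2)[THEN subgroup.mem_carrier] by fastforce
next
  assume "M \<subseteq> K \<and> N \<subseteq> K"
  then show "M <#> N \<subseteq> K"
    using subgroup.m_closed[OF assms(3)] by (auto simp: set_mult_def)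
qed

text \<open>A transposed character table without coordinates: \<open>c h\<close> is the row of the table of \<open>G\<close> matched with
the class of \<open>h\<close>, and \<open>p g\<close> is the character of \<open>H\<close> matched with the column of \<open>g\<close>. The last
assumption reflects that the identity of \<open>H\<close> is alone in its conjugacy class; it normalises the
sizes of the fibres of \<open>c\<close>.\<close>

locale character_pairing = G: group G + H: group H
  for G :: "('a, 'm) monoid_scheme" and H :: "('b, 'n) monoid_scheme" +
  fixes c :: "'b \<Rightarrow> 'a \<Rightarrow> complex" and p :: "'a \<Rightarrow> 'b \<Rightarrow> complex"
  assumes finite_G: "finite (carrier G)" and finite_H: "finite (carrier H)"
    and c_image: "c ` carrier H = irr_chars G"
    and p_image: "p ` carrier G = irr_chars H"
    and pairing: "\<And>g h. g \<in> carrier G \<Longrightarrow> h \<in> carrier H \<Longrightarrow>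
      c h \<one>\<^bsub>G\<^esub> * p g h = c h g * p g \<one>\<^bsub>H\<^esub>"
    and c_one: "\<And>h. h \<in> carrier H \<Longrightarrow> c h = c \<one>\<^bsub>H\<^esub> \<Longrightarrow> h = \<one>\<^bsub>H\<^esub>"
begin

lemma c_irr: "h \<in> carrier H \<Longrightarrow> c h \<in> irr_chars G" and p_irr: "g \<in> carrier G \<Longrightarrow> p g \<in> irr_chars H"
  using c_image p_image by auto

lemma degrees_nonzero:
  "h \<in> carrier H \<Longrightarrow> c h \<one>\<^bsub>G\<^esub> \<noteq> 0" "g \<in> carrier G \<Longrightarrow> p g \<one>\<^bsub>H\<^esub> \<noteq> 0"
  using G.irr_char_degree_nonzero H.irr_char_degree_nonzero c_irr p_irr by auto

lemma kernel_duality: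
  assumes "g \<in> carrier G" "h \<in> carrier H"
  shows "h \<in> char_kernel H (p g) \<longleftrightarrow> g \<in> char_kernel G (c h)"
  using pairing[OF assms] degrees_nonzero assms by (auto simp: char_kernel_def)

text \<open>By the duality, \<open>p g\<close> is trivial on \<open>H\<close> if and only if \<open>g\<close> lies in the kernel of every irreducible
character of \<open>G\<close>; these kernels intersect in the identity.\<close>

lemma kernel_everything_iff:
  assumes g: "g \<in> carrier G"
  shows "carrier H \<subseteq> char_kernel H (p g) \<longleftrightarrow> g = \<one>\<^bsub>G\<^esub>"
proof
  assume *: "carrier H \<subseteq> char_kernel H (p g)"
  have "g \<in> {\<one>\<^bsub>G\<^esub>}"
  proof (rule G.mem_normal_if_mem_char_kernels[OF finite_G G.one_is_normal g])
    fix \<chi> assume "\<chi> \<in> irr_chars G"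
    then obtain h where "h \<in> carrier H" "\<chi> = c h" using c_image by auto
    then show "g \<in> char_kernel G \<chi>" using * kernel_duality[OF g] by auto
  qed
  then show "g = \<one>\<^bsub>G\<^esub>" by simp
next
  assume "g = \<one>\<^bsub>G\<^esub>"
  then show "carrier H \<subseteq> char_kernel H (p g)"
    using kernel_duality by (auto simp: char_kernel_def)
qed

definition fibre_card :: "('a \<Rightarrow> complex) \<Rightarrow> nat" where
  "fibre_card \<chi> = card {h \<in> carrier H. c h = \<chi>}"

text \<open>Grouping the elements of \<open>H\<close> by fibres turns the left-hand side into the sum of \<open>p g\<close> over \<open>H\<close>,
divided by the degree of \<open>p g\<close>. That sum vanishes unless \<open>p g\<close> is trivial on \<open>H\<close>.\<close>

lemma fibre_weighted_sum:
  assumes g: "g \<in> carrier G"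
  shows "(\<Sum>\<chi>\<in>irr_chars G. of_nat (fibre_card \<chi>) / \<chi> \<one>\<^bsub>G\<^esub> * \<chi> g) =
    (if g = \<one>\<^bsub>G\<^esub> then of_nat (card (carrier H)) else 0)"
proof -
  have "(\<Sum>\<chi>\<in>irr_chars G. of_nat (fibre_card \<chi>) / \<chi> \<one>\<^bsub>G\<^esub> * \<chi> g) =
    (\<Sum>\<chi>\<in>irr_chars G. \<Sum>h | h \<in> carrier H \<and> c h = \<chi>. c h g / c h \<one>\<^bsub>G\<^esub>)"
    by (intro sum.cong refl) (simp add: fibre_card_def)
  also have "\<dots> = (\<Sum>h\<in>carrier H. c h g / c h \<one>\<^bsub>G\<^esub>)"
    by (rule sum.group) (use finite_H G.finite_irr_chars[OF finite_G] c_image in auto)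
  also have "\<dots> = (\<Sum>h\<in>carrier H. p g (\<one>\<^bsub>H\<^esub> \<otimes>\<^bsub>H\<^esub> h) / p g \<one>\<^bsub>H\<^esub>)"
    by (intro sum.cong refl) (use pairing[OF g] degrees_nonzero g in \<open>simp add: field_simps\<close>)
  also have "\<dots> = (\<Sum>h\<in>carrier H. p g (\<one>\<^bsub>H\<^esub> \<otimes>\<^bsub>H\<^esub> h)) / p g \<one>\<^bsub>H\<^esub>"
    by (simp add: sum_divide_distrib)
  also have "(\<Sum>h\<in>carrier H. p g (\<one>\<^bsub>H\<^esub> \<otimes>\<^bsub>H\<^esub> h)) =
    (if carrier H \<subseteq> char_kernel H (p g) then of_nat (card (carrier H)) * p g \<one>\<^bsub>H\<^esub> else 0)"
    by (rule H.irr_char_normal_coset_sum[OF finite_H p_irr[OF g]])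
      (auto intro: H.normal_invI H.subgroup_self)
  finally show ?thesis
    using degrees_nonzero(2)[OF g] unfolding kernel_everything_iff[OF g] by auto
qed

text \<open>Pair both sides of the preceding identity with \<open>\<psi>\<close>: orthogonality isolates the coefficient of \<open>\<psi>\<close>.\<close>

lemma fibre_card_proportional:
  assumes \<psi>: "\<psi> \<in> irr_chars G"
  shows "of_nat (card (carrier G)) * of_nat (fibre_card \<psi>) = of_nat (card (carrier H)) * (\<psi> \<one>\<^bsub>G\<^esub>)\<^sup>2"
proof -
  have finI: "finite (irr_chars G)" by (rule G.finite_irr_chars[OF finite_G])
  have "of_nat (fibre_card \<psi>) / \<psi> \<one>\<^bsub>G\<^esub> * of_nat (card (carrier G)) =
    (\<Sum>\<chi>\<in>irr_chars G. if \<chi> = \<psi> then of_nat (fibre_card \<psi>) / \<psi> \<one>\<^bsub>G\<^esub> * of_nat (card (carrier G)) else 0)"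
    using finI \<psi> by simp
  also have "\<dots> = (\<Sum>\<chi>\<in>irr_chars G. of_nat (fibre_card \<chi>) / \<chi> \<one>\<^bsub>G\<^esub> * (\<Sum>g\<in>carrier G. \<chi> g * \<psi> (inv\<^bsub>G\<^esub> g)))"
    by (intro sum.cong refl) (simp add: G.irr_chars_orthogonality[OF _ \<psi>])
  also have "\<dots> = (\<Sum>g\<in>carrier G. (\<Sum>\<chi>\<in>irr_chars G. of_nat (fibre_card \<chi>) / \<chi> \<one>\<^bsub>G\<^esub> * \<chi> g) * \<psi> (inv\<^bsub>G\<^esub> g))"
    by (subst sum_distrib_left, subst sum.swap) (simp add: sum_distrib_right mult.assoc)
  also have "\<dots> = (\<Sum>g\<in>carrier G. if g = \<one>\<^bsub>G\<^esub> then of_nat (card (carrier H)) * \<psi> \<one>\<^bsub>G\<^esub> else 0)"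
    by (intro sum.cong refl, subst fibre_weighted_sum) auto
  also have "\<dots> = of_nat (card (carrier H)) * \<psi> \<one>\<^bsub>G\<^esub>" using finite_G by simp
  finally show ?thesis
    using G.irr_char_degree_nonzero[OF \<psi>] by (simp add: field_simps power2_eq_square)
qed

text \<open>The fibre over \<open>c 1\<close> is \<open>{1}\<close>, and \<open>c 1\<close> is a constant function by the pairing, so its degree is
one. Proportionality of fibre sizes and squared degrees then compares the two group orders.\<close>

lemma card_eq: "card (carrier G) = card (carrier H)"
proof -
  have \<chi>: "c \<one>\<^bsub>H\<^esub> \<in> irr_chars G" by (simp add: c_irr)
  have "{h \<in> carrier H. c h = c \<one>\<^bsub>H\<^esub>} = {\<one>\<^bsub>H\<^esub>}" using c_one by auto
  then have one: "fibre_card (c \<one>\<^bsub>H\<^esub>) = 1" by (simp add: fibre_card_def)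
  have const: "c \<one>\<^bsub>H\<^esub> g = c \<one>\<^bsub>H\<^esub> \<one>\<^bsub>G\<^esub>" if "g \<in> carrier G" for g
    using pairing[OF that H.one_closed] degrees_nonzero(2)[OF that] by simp
  have "(\<Sum>g\<in>carrier G. c \<one>\<^bsub>H\<^esub> g * c \<one>\<^bsub>H\<^esub> (inv\<^bsub>G\<^esub> g)) = of_nat (card (carrier G))"
    using G.irr_chars_orthogonality[OF \<chi> \<chi>] by simp
  moreover have "(\<Sum>g\<in>carrier G. c \<one>\<^bsub>H\<^esub> g * c \<one>\<^bsub>H\<^esub> (inv\<^bsub>G\<^esub> g)) =
    of_nat (card (carrier G)) * (c \<one>\<^bsub>H\<^esub> \<one>\<^bsub>G\<^esub>)\<^sup>2"
  proof -
    have "(\<Sum>g\<in>carrier G. c \<one>\<^bsub>H\<^esub> g * c \<one>\<^bsub>H\<^esub> (inv\<^bsub>G\<^esub> g)) =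
      (\<Sum>g\<in>carrier G. (c \<one>\<^bsub>H\<^esub> \<one>\<^bsub>G\<^esub>)\<^sup>2)"
    proof (intro sum.cong refl)
      fix g assume g: "g \<in> carrier G"
      show "c \<one>\<^bsub>H\<^esub> g * c \<one>\<^bsub>H\<^esub> (inv\<^bsub>G\<^esub> g) = (c \<one>\<^bsub>H\<^esub> \<one>\<^bsub>G\<^esub>)\<^sup>2"
        unfolding const[OF g] const[OF G.inv_closed[OF g]] power2_eq_square ..
    qed
    then show ?thesis by simp
  qed
  moreover have "card (carrier G) \<noteq> 0" using finite_G by auto
  ultimately have "(c \<one>\<^bsub>H\<^esub> \<one>\<^bsub>G\<^esub>)\<^sup>2 = 1" by simp
  then have "(of_nat (card (carrier G)) :: complex) = of_nat (card (carrier H))"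
    using fibre_card_proportional[OF \<chi>] one by simp
  then show ?thesis using of_nat_eq_iff by blast
qed

lemma fibre_card_eq_degree_square:
  assumes "\<psi> \<in> irr_chars G"
  shows "of_nat (fibre_card \<psi>) = (\<psi> \<one>\<^bsub>G\<^esub>)\<^sup>2"
proof -
  have "card (carrier H) \<noteq> 0" using finite_H by auto
  then show ?thesis using fibre_card_proportional[OF assms] card_eq by simp
qed

definition ann :: "'a set \<Rightarrow> 'b set" where
  "ann N = {h \<in> carrier H. N \<subseteq> char_kernel G (c h)}"

definition coann :: "'b set \<Rightarrow> 'a set" where
  "coann M = {g \<in> carrier G. M \<subseteq> char_kernel H (p g)}"

lemma ann_eq_inter_kernels:
  assumes "N \<subseteq> carrier G"
  shows "ann N = {h \<in> carrier H. \<forall>\<psi>\<in>p ` N. h \<in> char_kernel H \<psi>}"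
  using assms kernel_duality by (auto simp: ann_def)

lemma coann_eq_inter_kernels:
  assumes "M \<subseteq> carrier H"
  shows "coann M = {g \<in> carrier G. \<forall>\<chi>\<in>c ` M. g \<in> char_kernel G \<chi>}"
  using assms kernel_duality by (auto simp: coann_def)

lemma ann_normal: "N \<subseteq> carrier G \<Longrightarrow> ann N \<lhd> H"
  using H.inter_char_kernels_normal[OF finite_H, of "p ` N"] p_irr
  by (auto simp: ann_eq_inter_kernels)

lemma coann_normal: "M \<subseteq> carrier H \<Longrightarrow> coann M \<lhd> G"
  using G.inter_char_kernels_normal[OF finite_G, of "c ` M"] c_irr
  by (auto simp: coann_eq_inter_kernels)

lemma coann_ann:
  assumes N: "N \<lhd> G"
  shows "coann (ann N) = N"
proof
  have Nc: "N \<subseteq> carrier G" using N by (simp add: normal_imp_subgroup subgroup.subset)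
  show "N \<subseteq> coann (ann N)"
    using Nc kernel_duality by (auto simp: ann_def coann_def)
  show "coann (ann N) \<subseteq> N"
  proof
    fix g assume g: "g \<in> coann (ann N)"
    then have gc: "g \<in> carrier G" by (simp add: coann_def)
    show "g \<in> N"
    proof (rule G.mem_normal_if_mem_char_kernels[OF finite_G N gc])
      fix \<chi> assume \<chi>: "\<chi> \<in> irr_chars G" "N \<subseteq> char_kernel G \<chi>"
      then obtain h where h: "h \<in> carrier H" "\<chi> = c h" unfolding c_image[symmetric] by blast
      then have "h \<in> ann N" using \<chi>(2) by (simp add: ann_def)
      then show "g \<in> char_kernel G \<chi>"
        using g h(2) kernel_duality[OF gc h(1)] by (auto simp: coann_def)
    qed
  qed
qed

lemma ann_coann:
  assumes M: "M \<lhd> H"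
  shows "ann (coann M) = M"
proof
  have Mc: "M \<subseteq> carrier H" using M by (simp add: normal_imp_subgroup subgroup.subset)
  show "M \<subseteq> ann (coann M)"
    using Mc kernel_duality by (auto simp: ann_def coann_def)
  show "ann (coann M) \<subseteq> M"
  proof
    fix h assume h: "h \<in> ann (coann M)"
    then have hc: "h \<in> carrier H" by (simp add: ann_def)
    show "h \<in> M"
    proof (rule H.mem_normal_if_mem_char_kernels[OF finite_H M hc])
      fix \<psi> assume \<psi>: "\<psi> \<in> irr_chars H" "M \<subseteq> char_kernel H \<psi>"
      then obtain g where g: "g \<in> carrier G" "\<psi> = p g" unfolding p_image[symmetric] by blast
      then have "g \<in> coann M" using \<psi>(2) by (simp add: coann_def)
      then show "h \<in> char_kernel H \<psi>"
        using h g(2) kernel_duality[OF g(1) hc] by (auto simp: ann_def)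
    qed
  qed
qed

text \<open>\<open>ann N\<close> is the union of the fibres over the characters with kernel above \<open>N\<close>, so its order is the sum
of their squared degrees, which is the index of \<open>N\<close>.\<close>

lemma card_ann:
  assumes N: "N \<lhd> G"
  shows "card N * card (ann N) = card (carrier G)"
proof -
  define A where "A = {\<chi> \<in> irr_chars G. N \<subseteq> char_kernel G \<chi>}"
  have finA: "finite A" using G.finite_irr_chars[OF finite_G] by (simp add: A_def)
  have "of_nat (card (ann N)) = (\<Sum>h\<in>ann N. 1 :: complex)" by simp
  also have "\<dots> = (\<Sum>\<chi>\<in>A. \<Sum>h | h \<in> ann N \<and> c h = \<chi>. 1)"
    by (rule sum.group[symmetric])
      (use finA finite_H c_irr in \<open>auto simp: A_def ann_def\<close>)
  also have "\<dots> = (\<Sum>\<chi>\<in>A. \<chi> \<one>\<^bsub>G\<^esub> * \<chi> \<one>\<^bsub>G\<^esub>)"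
  proof (intro sum.cong refl)
    fix \<chi> assume \<chi>: "\<chi> \<in> A"
    then have "{h. h \<in> ann N \<and> c h = \<chi>} = {h \<in> carrier H. c h = \<chi>}"
      by (auto simp: A_def ann_def)
    then show "(\<Sum>h | h \<in> ann N \<and> c h = \<chi>. 1) = \<chi> \<one>\<^bsub>G\<^esub> * \<chi> \<one>\<^bsub>G\<^esub>"
      using fibre_card_eq_degree_square[of \<chi>] \<chi> by (simp add: A_def fibre_card_def power2_eq_square)
  qed
  finally have "of_nat (card N) * of_nat (card (ann N)) = (of_nat (card (carrier G)) :: complex)"
    using G.irr_chars_normal_column_sum[OF finite_G N G.one_closed] N
    by (simp add: A_def normal_imp_subgroup subgroup.one_closed)
  then show ?thesis using of_nat_eq_iff of_nat_mult by metis
qed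

lemma ann_antimono: "N1 \<subseteq> N2 \<Longrightarrow> ann N2 \<subseteq> ann N1"
  by (auto simp: ann_def)

lemma coann_antimono: "M1 \<subseteq> M2 \<Longrightarrow> coann M2 \<subseteq> coann M1"
  by (auto simp: coann_def)

lemma ann_set_mult:
  assumes "N1 \<lhd> G" "N2 \<lhd> G"
  shows "ann (N1 <#>\<^bsub>G\<^esub> N2) = ann N1 \<inter> ann N2"
proof -
  have "N1 <#>\<^bsub>G\<^esub> N2 \<subseteq> char_kernel G (c h) \<longleftrightarrow> N1 \<subseteq> char_kernel G (c h) \<and> N2 \<subseteq> char_kernel G (c h)"
    if "h \<in> carrier H" for h
    by (intro G.set_mult_subset_iff normal_imp_subgroup G.char_kernel_normal[OF finite_G])
      (use assms c_irr[OF that] in auto)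
  then show ?thesis by (auto simp: ann_def)
qed

lemma coann_set_mult:
  assumes "M1 \<lhd> H" "M2 \<lhd> H"
  shows "coann (M1 <#>\<^bsub>H\<^esub> M2) = coann M1 \<inter> coann M2"
proof -
  have "M1 <#>\<^bsub>H\<^esub> M2 \<subseteq> char_kernel H (p g) \<longleftrightarrow> M1 \<subseteq> char_kernel H (p g) \<and> M2 \<subseteq> char_kernel H (p g)"
    if "g \<in> carrier G" for g
    by (intro H.set_mult_subset_iff normal_imp_subgroup H.char_kernel_normal[OF finite_H])
      (use assms p_irr[OF that] in auto)
  then show ?thesis by (auto simp: coann_def)
qed

text \<open>The product of \<open>ann N1\<close> and \<open>ann N2\<close> is normal, hence closed, and \<open>coann\<close> sends it to
\<open>N1 \<inter> N2\<close>; applying \<open>ann\<close> recovers the product.\<close>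

lemma ann_Int:
  assumes N1: "N1 \<lhd> G" and N2: "N2 \<lhd> G"
  shows "ann (N1 \<inter> N2) = ann N1 <#>\<^bsub>H\<^esub> ann N2"
proof -
  have n: "ann N1 \<lhd> H" "ann N2 \<lhd> H"
    using assms ann_normal by (simp_all add: normal_imp_subgroup subgroup.subset)
  have "N1 \<inter> N2 = coann (ann N1 <#>\<^bsub>H\<^esub> ann N2)"
    by (simp add: coann_set_mult[OF n] coann_ann assms)
  then show ?thesis by (simp add: ann_coann H.normal_set_mult_normal[OF n])
qed

end

section \<open>From the transposed table to the pairing\<close>

lemma conj_classes_iff:
  fixes G (structure)
  shows "C \<in> conj_classes G \<longleftrightarrow> (\<exists>x\<in>carrier G. C = (\<lambda>a. a \<otimes> x \<otimes> inv a) ` carrier G)"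
  by (auto simp: conj_classes_def orbits_def orbit_def image_def)

lemma (in group) conj_class_eq:
  assumes "C \<in> conj_classes G" "g \<in> C"
  shows "C = (\<lambda>a. a \<otimes> g \<otimes> inv a) ` carrier G"
proof -
  obtain x b where x: "x \<in> carrier G" "C = (\<lambda>a. a \<otimes> x \<otimes> inv a) ` carrier G"
    and b: "b \<in> carrier G" "g = b \<otimes> x \<otimes> inv b"
    using assms unfolding conj_classes_iff by auto
  have cancel: "inv b \<otimes> (b \<otimes> y) = y" if "y \<in> carrier G" for y
    using that b(1) by (simp add: m_assoc[symmetric])
  show ?thesis
  proof (intro equalityI subsetI)
    fix y assume "y \<in> C"
    then obtain a where a: "a \<in> carrier G" "y = a \<otimes> x \<otimes> inv a" using x(2) by auto
    then have "y = (a \<otimes> inv b) \<otimes> g \<otimes> inv (a \<otimes> inv b)"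
      using b x(1) by (simp add: m_assoc inv_mult_group cancel)
    then show "y \<in> (\<lambda>a. a \<otimes> g \<otimes> inv a) ` carrier G"
      using a(1) b(1) by (intro image_eqI[of _ _ "a \<otimes> inv b"]) auto
  next
    fix y assume "y \<in> (\<lambda>a. a \<otimes> g \<otimes> inv a) ` carrier G"
    then obtain a where a: "a \<in> carrier G" "y = a \<otimes> g \<otimes> inv a" by auto
    then have "y = (a \<otimes> b) \<otimes> x \<otimes> inv (a \<otimes> b)"
      using b x(1) by (simp add: m_assoc inv_mult_group)
    then show "y \<in> C"
      unfolding x(2) using a(1) b(1) by (intro image_eqI[of _ _ "a \<otimes> b"]) auto
  qed
qed

lemma (in group) Union_conj_classes: "\<Union> (conj_classes G) = carrier G"
proof (intro equalityI subsetI)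
  fix g assume "g \<in> \<Union> (conj_classes G)"
  then obtain x where "x \<in> carrier G" "g \<in> (\<lambda>a. a \<otimes> x \<otimes> inv a) ` carrier G"
    by (auto simp: conj_classes_iff)
  then show "g \<in> carrier G" by auto
next
  fix g assume g: "g \<in> carrier G"
  then have "g \<in> (\<lambda>a. a \<otimes> g \<otimes> inv a) ` carrier G"
    by (intro image_eqI[of _ _ \<one>]) auto
  moreover have "(\<lambda>a. a \<otimes> g \<otimes> inv a) ` carrier G \<in> conj_classes G"
    using g unfolding conj_classes_iff by blast
  ultimately show "g \<in> \<Union> (conj_classes G)" by blast
qed

text \<open>As distinct classes are disjoint, the position of its class in the list is determined by an element,
and every position occurs. The identity is alone in its class, so it shares its position with no
other element.\<close>

lemma (in group) conj_class_index:
  assumes "distinct Cs" "set Cs = conj_classes G"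
  obtains idx where "\<And>g. g \<in> carrier G \<Longrightarrow> idx g < length Cs" "\<And>g. g \<in> carrier G \<Longrightarrow> g \<in> Cs ! idx g"
    "idx ` carrier G = {..<length Cs}" "\<And>g. g \<in> carrier G \<Longrightarrow> idx g = idx \<one> \<Longrightarrow> g = \<one>"
proof -
  have "\<exists>j<length Cs. g \<in> Cs ! j" if "g \<in> carrier G" for g
    using that Union_conj_classes assms(2) by (metis UnionE in_set_conv_nth)
  then obtain idx where idx: "\<And>g. g \<in> carrier G \<Longrightarrow> idx g < length Cs" "\<And>g. g \<in> carrier G \<Longrightarrow> g \<in> Cs ! idx g"
    by metis
  have cls: "Cs ! j \<in> conj_classes G" if "j < length Cs" for j using that assms(2) nth_mem by blast
  have "j \<in> idx ` carrier G" if j: "j < length Cs" for j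
  proof -
    obtain g where g: "g \<in> Cs ! j" "g \<in> carrier G"
      using cls[OF j] unfolding conj_classes_iff by fastforce
    have "Cs ! j = Cs ! idx g"
      using conj_class_eq[OF cls[OF j] g(1)] conj_class_eq[OF cls[OF idx(1)] idx(2)] g(2) by simp
    then show ?thesis using assms(1) j idx(1) g(2) by (metis imageI nth_eq_iff_index_eq)
  qed
  then have "idx ` carrier G = {..<length Cs}" using idx(1) by auto
  moreover have "g = \<one>" if "g \<in> carrier G" "idx g = idx \<one>" for g
  proof -
    have "Cs ! idx \<one> = {\<one>}"
      using conj_class_eq[OF cls[OF idx(1)] idx(2), of \<one>] by (auto simp: image_iff)
    then show ?thesis using idx(2)[OF that(1)] that(2) by simp
  qed
  ultimately show thesis using that idx by blast
qed

text \<open>Multiplying the matrix identity by \<open>D\<close> from the left removes the inverse and leaves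
\<open>\<chi>\<^sub>i(1) \<psi>\<^sub>j(h) = \<chi>\<^sub>i(g) \<psi>\<^sub>j(1)\<close>; the index maps of the classes then give \<open>c\<close> and \<open>p\<close>.\<close>

lemma transpose_group_character_pairing:
  assumes G: "group G" and finG: "finite (carrier G)" and T: "transpose_group G H"
  shows "\<exists>c p. character_pairing G H c p"
proof -
  interpret G: group G by fact
  obtain \<chi>s Cs X \<psi>s Ks D D' N\<^sub>0 and n :: "nat \<Rightarrow> nat"
    where H: "group H" and finH: "finite (carrier H)"
      and tG: "character_table G \<chi>s Cs X" and D: "D = degree_matrix G \<chi>s"
      and N0_diag: "N\<^sub>0 = mat_diag (length Cs) (\<lambda>j. of_nat (n j))" and N0: "N\<^sub>0 = degree_matrix H \<psi>s"
      and D': "D' \<in> carrier_mat (length \<chi>s) (length \<chi>s)" and DD': "inverts_mat D D'"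
      and tH: "character_table H \<psi>s Ks (transpose_mat (D' * X * N\<^sub>0))"
    using T unfolding transpose_group_def by blast
  interpret H: group H by fact
  define Y where "Y = D' * X * N\<^sub>0"
  have X: "X \<in> carrier_mat (length \<chi>s) (length Cs)" using tG by (simp add: character_table_def)
  have len: "length \<psi>s = length Cs" using arg_cong[OF N0_diag, of dim_row] by (simp add: N0 degree_matrix_def mat_diag_def)
  have N0c: "N\<^sub>0 \<in> carrier_mat (length Cs) (length Cs)"
    using len by (simp add: N0 degree_matrix_def mat_diag_def)
  have Y: "Y \<in> carrier_mat (length \<chi>s) (length Cs)" using D' X N0c by (simp add: Y_def)
  have lenK: "length Ks = length \<chi>s" using tH Y by (auto simp: character_table_def Y_def[symmetric])
  have Dc: "D \<in> carrier_mat (length \<chi>s) (length \<chi>s)" by (simp add: D degree_matrix_def mat_diag_def)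
  have DY: "D * Y = X * N\<^sub>0"
  proof -
    have "D * Y = D * (D' * (X * N\<^sub>0))" unfolding Y_def using assoc_mult_mat[OF D' X N0c] by simp
    also have "\<dots> = D * D' * (X * N\<^sub>0)"
      by (rule assoc_mult_mat[OF Dc D' mult_carrier_mat[OF X N0c], symmetric])
    also have "D * D' = 1\<^sub>m (length \<chi>s)" using DD' Dc by (simp add: inverts_mat_def)
    finally show ?thesis using X N0c by simp
  qed
  have rel: "(\<chi>s ! i) \<one>\<^bsub>G\<^esub> * Y $$ (i, j) = X $$ (i, j) * (\<psi>s ! j) \<one>\<^bsub>H\<^esub>"
    if "i < length \<chi>s" "j < length Cs" for i j
    using arg_cong[OF DY, of "\<lambda>M. M $$ (i, j)"] that
    unfolding D N0 degree_matrix_def len mat_diag_mult_left[OF Y] mat_diag_mult_right[OF X] by simp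
  obtain jx where jx: "\<And>g. g \<in> carrier G \<Longrightarrow> jx g < length Cs" "\<And>g. g \<in> carrier G \<Longrightarrow> g \<in> Cs ! jx g"
    "jx ` carrier G = {..<length Cs}"
    using G.conj_class_index[of Cs] tG unfolding character_table_def by metis
  obtain ix where ix: "\<And>h. h \<in> carrier H \<Longrightarrow> ix h < length Ks" "\<And>h. h \<in> carrier H \<Longrightarrow> h \<in> Ks ! ix h"
    "ix ` carrier H = {..<length Ks}" "\<And>h. h \<in> carrier H \<Longrightarrow> ix h = ix \<one>\<^bsub>H\<^esub> \<Longrightarrow> h = \<one>\<^bsub>H\<^esub>"
    using H.conj_class_index[of Ks] tH unfolding character_table_def by metis
  have "character_pairing G H (\<lambda>h. \<chi>s ! ix h) (\<lambda>g. \<psi>s ! jx g)"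
  proof (unfold_locales)
    show "(\<lambda>h. \<chi>s ! ix h) ` carrier H = irr_chars G"
    proof -
      have "(\<lambda>h. \<chi>s ! ix h) ` carrier H = (!) \<chi>s ` {..<length \<chi>s}"
        using ix(3) lenK by (simp add: image_image[symmetric])
      then show ?thesis using tG by (auto simp: character_table_def set_conv_nth)
    qed
    show "(\<lambda>g. \<psi>s ! jx g) ` carrier G = irr_chars H"
    proof -
      have "(\<lambda>g. \<psi>s ! jx g) ` carrier G = (!) \<psi>s ` {..<length \<psi>s}"
        using jx(3) len by (simp add: image_image[symmetric])
      then show ?thesis using tH by (auto simp: character_table_def set_conv_nth)
    qed
    show "(\<chi>s ! ix h) \<one>\<^bsub>G\<^esub> * (\<psi>s ! jx g) h = (\<chi>s ! ix h) g * (\<psi>s ! jx g) \<one>\<^bsub>H\<^esub>"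
      if g: "g \<in> carrier G" and h: "h \<in> carrier H" for g h
    proof -
      have i: "ix h < length \<chi>s" and j: "jx g < length Cs" using ix(1)[OF h] jx(1)[OF g] lenK by auto
      have "X $$ (ix h, jx g) = (\<chi>s ! ix h) g"
        using tG i j jx(2)[OF g] by (simp add: character_table_def)
      moreover have "transpose_mat Y $$ (jx g, ix h) = (\<psi>s ! jx g) h"
        using tH i j ix(2)[OF h] len lenK by (simp add: character_table_def Y_def)
      ultimately show ?thesis using rel[OF i j] Y i j by simp
    qed
    show "h = \<one>\<^bsub>H\<^esub>" if "h \<in> carrier H" "\<chi>s ! ix h = \<chi>s ! ix \<one>\<^bsub>H\<^esub>" for h
    proof -
      have "ix h = ix \<one>\<^bsub>H\<^esub>"
        using that tG ix(1)[OF that(1)] ix(1)[OF H.one_closed] lenK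
        by (simp add: character_table_def nth_eq_iff_index_eq)
      then show ?thesis using ix(4) that(1) by blast
    qed
  qed (rule finG finH)+
  then show ?thesis by blast
qed

theorem proposition3p4:
  fixes G :: "('a, 'm) monoid_scheme" and H :: "('b, 'n) monoid_scheme"
  assumes "group G" and "finite (carrier G)"
    and "transpose_group G H"
  shows "\<exists>T :: 'a set \<Rightarrow> 'b set.
    (\<forall>N. N \<lhd> G \<longrightarrow>
       T N \<lhd> H \<and> Coset.order (G Mod N) = card (T N) \<and> card N = Coset.order (H Mod T N)) \<and>
    (\<forall>N1 N2. N1 \<lhd> G \<and> N2 \<lhd> G \<longrightarrow>
       T (N1 <#>\<^bsub>G\<^esub> N2) = T N1 \<inter> T N2 \<and>
       T (N1 \<inter> N2) = T N1 <#>\<^bsub>H\<^esub> T N2 \<and>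
       (N1 \<subseteq> N2 \<longleftrightarrow> T N2 \<subseteq> T N1)) \<and>
    bij_betw T {N. N \<lhd> G} {M. M \<lhd> H}"
proof -
  obtain c p where "character_pairing G H c p"
    using transpose_group_character_pairing[OF assms] by blast
  then interpret character_pairing G H c p .
  have sub: "N \<subseteq> carrier G" if "N \<lhd> G" for N
    using that by (simp add: normal_imp_subgroup subgroup.subset)
  have subH: "M \<subseteq> carrier H" if "M \<lhd> H" for M
    using that by (simp add: normal_imp_subgroup subgroup.subset)
  have orders: "Coset.order (G Mod N) = card (ann N) \<and> card N = Coset.order (H Mod ann N)"
    if N: "N \<lhd> G" for N
  proof -
    have AN: "ann N \<lhd> H" using ann_normal[OF sub[OF N]] .
    have "card (carrier G) \<noteq> 0" using finite_G by auto
    then have "card N \<noteq> 0" "card (ann N) \<noteq> 0"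
      using card_ann[OF N] by (metis mult_eq_0_iff)+
    moreover have "Coset.order (G Mod N) * card N = card (carrier G)"
      using G.lagrange[OF normal_imp_subgroup[OF N]] by (simp add: Coset.order_def FactGroup_def)
    moreover have "Coset.order (H Mod ann N) * card (ann N) = card (carrier H)"
      using H.lagrange[OF normal_imp_subgroup[OF AN]] by (simp add: Coset.order_def FactGroup_def)
    ultimately show ?thesis
      using card_ann[OF N] card_eq by (metis mult.commute mult_right_cancel)
  qed
  have iff: "N1 \<subseteq> N2 \<longleftrightarrow> ann N2 \<subseteq> ann N1" if "N1 \<lhd> G" "N2 \<lhd> G" for N1 N2
    using ann_antimono[of N1 N2] coann_antimono[of "ann N2" "ann N1"] coann_ann that by auto
  have "bij_betw ann {N. N \<lhd> G} {M. M \<lhd> H}"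
    by (rule bij_betw_byWitness[where f' = coann])
      (use coann_ann ann_coann ann_normal coann_normal sub subH in auto)
  then show ?thesis
    using ann_normal sub orders iff ann_set_mult ann_Int by (intro exI[of _ ann]) auto
qed

end
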